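(* Let $k,l\ge1$ be integers, $\mu>0$, $\lambda_1,\dots,\lambda_l>0$, $\Lambda=\sum_{m=1}^l\lambda_m$, $c_m=\lambda_m/\Lambda$, $\theta>0$, $\alpha\in(0,1)$, and $\beta=\theta^\alpha-\Lambda-k\mu$. The zero state probability of the tempered Erlang queue with multiple arrivals $\mathcal{Q}^{\theta,\alpha}$ is, for $t\ge0$, \begin{align*} p_{0}^{\theta,\alpha}(t)=\sum_{h=1}^{\infty}\sum_{n=0}^{\infty}\sum_{\substack{\mathbf{m}\in\mathbb{N}_0^l\\ m_1+\dots+m_l=n}}\sum_{q=0}^{\infty}C_{h,n}^{0}(\mathbf{m})e^{-\theta t}\theta^q t^{\beta_{h,n}^{0}(\mathbf{m})+q-1}\Big(E_{\alpha,\beta_{h,n}^{0}(\mathbf{m})+q}^{\gamma_{h,n}^{0}(\mathbf{m})}(\beta t^{\alpha})-(\theta t)^\alpha E_{\alpha,\beta_{h,n}^{0}(\mathbf{m})+\alpha+q}^{\gamma_{h,n}^{0}(\mathbf{m})}(\beta t^{\alpha})\Big). \end{align*}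
   Context: Erlang queue with multiple arrivals: $\{\mathcal{Q}(t)\}_{t\ge0}$ is the continuous-time Markov chain on $\{(0,0)\}\cup S$, $S=\{(n,s)\in\mathbb{N}\times\mathbb{N}: n\ge1,\ 1\le s\le k\}$ (number of customers, phase of customer in service), started at $(0,0)$, with transition rates: $(0,0)\to(m,k)$ at rate $\lambda_m$; $(n,s)\to(n+m,s)$ at rate $\lambda_m$ ($m=1,\dots,l$); $(n,s)\to(n,s-1)$ at rate $k\mu$ for $s\ge2$; $(n,1)\to(n-1,k)$ at rate $k\mu$ for $n\ge2$; $(1,1)\to(0,0)$ at rate $k\mu$. Let $D_{\theta,\alpha}$ be the subordinator with $\mathbb{E}e^{-sD_{\theta,\alpha}(t)}=e^{-t((s+\theta)^\alpha-\theta^\alpha)}$, $Y_{\theta,\alpha}(t)=\inf\{x>0:D_{\theta,\alpha}(x)>t\}$ independent of $\mathcal Q$, and $\mathcal{Q}^{\theta,\alpha}(t)=\mathcal{Q}(Y_{\theta,\alpha}(t))$; $p_0^{\theta,\alpha}(t)=\Pr(\mathcal{Q}^{\theta,\alpha}(t)=(0,0)\mid\mathcal{Q}^{\theta,\alpha}(0)=(0,0))$. Notation: for $h\ge1$, $n\ge0$, $\mathbf m=(m_1,\dots,m_l)\in\mathbb N_0^l$: $\gamma_{h,n}^{0}(\mathbf{m})=h+n+k\sum_{j=1}^{l}jm_{j}$, $\beta_{h,n}^{0}(\mathbf{m})=\alpha(\gamma_{h,n}^{0}(\mathbf{m})-1)+1$, $C_{h,n}^{0}(\mathbf{m})=h\Lambda^{n}\Big(\prod_{i=1}^{l}\frac{c_{i}^{m_{i}}}{m_{i}!}\Big)\frac{(k\mu)^{\gamma_{h,n}^{0}(\mathbf{m})-n-1}}{(\gamma_{h,n}^{0}(\mathbf{m})-n)!}(\gamma_{h,n}^{0}(\mathbf{m})-1)!$.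 Three-parameter Mittag-Leffler function: $E_{\alpha,b}^{\gamma}(x)=\frac{1}{\Gamma(\gamma)}\sum_{j=0}^{\infty}\frac{\Gamma(j+\gamma)x^j}{j!\,\Gamma(\alpha j+b)}$. *)

theory Defs
  imports "HOL-Probability.Probability"
begin

text \<open>Transition rates of the Erlang queue with multiple arrivals on states (n,s).
  Parameters: k (phases), l (max batch size), mu, lam (lam m = lambda_m for m = 1..l).
  States outside {(0,0)} union S have all rates 0 (they are never visited).\<close>
definition erlang_rate :: "nat \<Rightarrow> nat \<Rightarrow> real \<Rightarrow> (nat \<Rightarrow> real) \<Rightarrow> nat \<times> nat \<Rightarrow> nat \<times> nat \<Rightarrow> real" where
  "erlang_rate k l mu lam i j = (case i of (a, b) \<Rightarrow> case j of (c, d) \<Rightarrow>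
     if a = 0 \<and> b = 0 then (if d = k \<and> 1 \<le> c \<and> c \<le> l then lam c else 0)
     else if 1 \<le> a \<and> 1 \<le> b \<and> b \<le> k then
         (if d = b \<and> a < c \<and> c - a \<le> l then lam (c - a) else 0)
       + (if 2 \<le> b \<and> c = a \<and> d = b - 1 then real k * mu else 0)
       + (if b = 1 \<and> 2 \<le> a \<and> c = a - 1 \<and> d = k then real k * mu else 0)
       + (if a = 1 \<and> b = 1 \<and> c = 0 \<and> d = 0 then real k * mu else 0)
     else 0)"

definition erlang_gen :: "nat \<Rightarrow> nat \<Rightarrow> real \<Rightarrow> (nat \<Rightarrow> real) \<Rightarrow> nat \<times> nat \<Rightarrow> nat \<times> nat \<Rightarrow> real" where
  "erlang_gen k l mu lam i j =
     (if i = j then - infsum (\<lambda>j'. if j' = i then 0 else erlang_rate k l mu lam i j') UNIV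
      else erlang_rate k l mu lam i j)"

text \<open>Powers of the generator (rows have finite support).\<close>
primrec erlang_gen_pow :: "nat \<Rightarrow> nat \<Rightarrow> real \<Rightarrow> (nat \<Rightarrow> real) \<Rightarrow> nat \<Rightarrow> nat \<times> nat \<Rightarrow> nat \<times> nat \<Rightarrow> real" where
  "erlang_gen_pow k l mu lam 0 i j = (if i = j then 1 else 0)"
| "erlang_gen_pow k l mu lam (Suc n) i j =
     infsum (\<lambda>r. erlang_gen k l mu lam i r * erlang_gen_pow k l mu lam n r j) UNIV"

text \<open>Transition function P(t) = exp(t G) of the chain (the generator is bounded).\<close>
definition erlang_trans :: "nat \<Rightarrow> nat \<Rightarrow> real \<Rightarrow> (nat \<Rightarrow> real) \<Rightarrow> real \<Rightarrow> nat \<times> nat \<Rightarrow> nat \<times> nat \<Rightarrow> real" where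
  "erlang_trans k l mu lam t i j = (\<Sum>n. t ^ n / fact n * erlang_gen_pow k l mu lam n i j)"

definition mittag_leffler3 :: "real \<Rightarrow> real \<Rightarrow> real \<Rightarrow> real \<Rightarrow> real" where
  "mittag_leffler3 a b g x =
     (1 / Gamma g) * (\<Sum>j. Gamma (real j + g) * x ^ j / (fact j * Gamma (a * real j + b)))"

text \<open>Real power with the convention x^0 = 1 (Isabelle's powr has 0 powr 0 = 0).\<close>
definition pw :: "real \<Rightarrow> real \<Rightarrow> real" where
  "pw x a = (if a = 0 then 1 else x powr a)"

definition multi_idx :: "nat \<Rightarrow> nat \<Rightarrow> (nat \<Rightarrow> nat) set" where
  "multi_idx l n = {m. (\<forall>i. i \<notin> {1..l} \<longrightarrow> m i = 0) \<and> (\<Sum>i=1..l. m i) = n}"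

definition gamma0 :: "nat \<Rightarrow> nat \<Rightarrow> nat \<Rightarrow> nat \<Rightarrow> (nat \<Rightarrow> nat) \<Rightarrow> nat" where
  "gamma0 k l h n m = h + n + k * (\<Sum>j=1..l. j * m j)"

definition beta0 :: "real \<Rightarrow> nat \<Rightarrow> real" where
  "beta0 alpha g = alpha * (real g - 1) + 1"

definition C0 :: "nat \<Rightarrow> nat \<Rightarrow> real \<Rightarrow> real \<Rightarrow> (nat \<Rightarrow> real) \<Rightarrow> nat \<Rightarrow> nat \<Rightarrow> (nat \<Rightarrow> nat) \<Rightarrow> real" where
  "C0 k l mu Lam c h n m =
     (let g = gamma0 k l h n m in
      real h * Lam ^ n * (\<Prod>i=1..l. c i ^ m i / fact (m i))
      * (real k * mu) ^ (g - n - 1) / fact (g - n) * fact (g - 1))"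

end

(* Number the states by the phases x that remain to be served. Uniformised with rate c = Lambda + k mu,
   the chain is the random walk with steps k m (weight lambda_m) and -1 (weight k mu) that is held at 0
   by the step -1, so p_0(t) = exp (- c t) sum_N r_N t^N / N!, where r_N is the weight of the paths of
   length N from 0 to 0. Such a path is determined by a free path of length N + 1 that hits some level
   -h with h >= 1 for the first time in its last step, and by the hitting time theorem these have weight
   h / (N + 1) times that of all free paths from 0 to -h. Expanding the latter with the multinomial
   theorem writes p_0 as a mixture of the functions x^(g-1) exp (- c x) / (g-1)!.

   The subordinator enters only through E phi(Y(t)) for these phi. If T is exponential with rate s and
   independent of D, then Y(T) is exponential with rate psi(s) = (s + theta)^alpha - theta^alpha, so the
   Laplace transform of t |-> E phi(Y(t)) is psi(s) / (s (psi(s) + c)^g). The series of Mittag-Leffler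
   functions has the same transform: after the shift by theta, its sum over j is the binomial series
   of (1 - beta s^(- alpha))^(- g) and its sum over q the geometric series of 1 / (1 - theta / s). Both
   sides are continuous in t, because D is almost surely strictly increasing, hence they agree. *)

theory Submission
  imports Defs
begin

text \<open>The hitting time theorem is not proved by counting paths. A path from x to 0 of the held
  walk, followed by one more held step, becomes a free path once held steps may go below 0. Here h
  is x plus the number of held steps, the appended one included, and dividing by the weight k mu of
  the appended step explains the exponent g - n - 1 in C. The formula so predicted is taken as the
  definition of \<open>walk_weight\<close>, which is then shown to satisfy the recursion of the
  walk; the holding at 0 becomes the vanishing of one coefficient. Summation is the other obstacle.
  The sums over N, h, n and m have nonnegative terms and are rearranged in \<open>ennreal\<close>,
  so that no convergence must be known in advance. The terms of the sums over j and q need not be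
  nonnegative; there every term carries a bound K exp (a t), with a so large that the constants K
  are summable. These transforms are hence computed for large s only, which is enough for
  uniqueness. The constant beta is theta^alpha - c, so that psi(s) + c = (s + theta)^alpha -
  beta.\<close>

section \<open>The chain of remaining phases\<close>

text \<open>State (n, s) is coded by the number of phases k (n - 1) + s that remain to be served.\<close>

definition phase_state :: "nat \<Rightarrow> nat \<Rightarrow> nat \<times> nat" where
  "phase_state k x = (if x = 0 then (0, 0) else (Suc ((x - 1) div k), Suc ((x - 1) mod k)))"

lemma phase_state_0 [simp]: "phase_state k 0 = (0, 0)"
  by (simp add: phase_state_def)

lemma inj_phase_state: "inj (phase_state k)"
proof (rule injI)
  fix x y assume eq: "phase_state k x = phase_state k y"
  then have "x = 0 \<longleftrightarrow> y = 0"
    by (auto simp: phase_state_def split: if_splits)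
  moreover have "x - 1 = y - 1" if "x \<noteq> 0" "y \<noteq> 0"
  proof -
    have "(x - 1) div k = (y - 1) div k" "(x - 1) mod k = (y - 1) mod k"
      using eq that by (simp_all add: phase_state_def)
    then show ?thesis
      by (metis mult_div_mod_eq)
  qed
  ultimately show "x = y"
    by (cases "x = 0") auto
qed

lemma phase_state_eq_iff [simp]: "phase_state k x = phase_state k y \<longleftrightarrow> x = y"
  by (rule inj_eq[OF inj_phase_state])

lemma phase_state_add:
  assumes "k \<ge> 1" "x \<ge> 1" "phase_state k x = (a, b)"
  shows "phase_state k (x + k * j) = (a + j, b)"
proof -
  obtain y where "x = Suc y"
    using assms by (cases x) auto
  then show ?thesis
    using assms by (auto simp: phase_state_def)
qed

text \<open>A batch of \<open>j\<close> arriving at the empty queue starts with all \<open>k\<close>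
  phases of its first customer ahead, so it adds \<open>k * j\<close> phases, the same amount as in
  a busy state.\<close>

lemma phase_state_mult:
  assumes "k \<ge> 1" "j \<ge> 1"
  shows "phase_state k (k * j) = (j, k)"
proof -
  obtain j' where j: "j = Suc j'"
    using assms by (cases j) auto
  have "phase_state k k = (1, k)"
    using assms by (auto simp: phase_state_def)
  from phase_state_add[OF assms(1) assms(1) this, of j'] show ?thesis
    by (simp add: j)
qed

text \<open>A finished phase, a departure that leaves customers behind and the departure of the last
  customer all become the same move.\<close>

lemma phase_state_pred:
  assumes "k \<ge> 1" "x \<ge> 1" "phase_state k x = (a, b)"
  shows "phase_state k (x - 1) =
    (if b \<ge> 2 then (a, b - 1) else if a \<ge> 2 then (a - 1, k) else (0, 0))"
proof -
  define y where "y = x - 1"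
  have a: "a = Suc (y div k)" and b: "b = Suc (y mod k)"
    using assms by (auto simp: phase_state_def y_def)
  show ?thesis
  proof (cases "y = 0")
    case True
    then show ?thesis
      using assms a b by (auto simp: y_def)
  next
    case False
    then obtain z where z: "y = Suc z" and x: "x = Suc (Suc z)"
      using assms that[of "x - 2"] by (auto simp: y_def)
    show ?thesis
    proof (cases "y mod k = 0")
      case True
      then have "Suc (z mod k) = k"
        using mod_Suc[of z k] z assms by (auto split: if_splits)
      moreover have "y div k = Suc (z div k)"
        using div_Suc[of z k] True z by simp
      ultimately show ?thesis
        using True a b z x by (auto simp: phase_state_def)
    next
      case False
      then have "Suc (z mod k) = y mod k"
        using mod_Suc[of z k] z by (auto split: if_splits)
      moreover have "y div k = z div k"
        using div_Suc[of z k] False z by simp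
      ultimately show ?thesis
        using False a b z x by (auto simp: phase_state_def)
    qed
  qed
qed

lemma phase_state_bounds:
  assumes "k \<ge> 1" "x \<ge> 1" "phase_state k x = (a, b)"
  shows "1 \<le> a" "1 \<le> b" "b \<le> k"
proof -
  have "a = Suc ((x - 1) div k)" "b = Suc ((x - 1) mod k)"
    using assms by (auto simp: phase_state_def)
  moreover have "(x - 1) mod k < k"
    using assms by simp
  ultimately show "1 \<le> a" "1 \<le> b" "b \<le> k"
    by linarith+
qed

lemma erlang_rate_phase_state:
  assumes k: "k \<ge> 1"
  shows "erlang_rate k l mu lam (phase_state k x) r =
    (\<Sum>j=1..l. if r = phase_state k (x + k * j) then lam j else 0) +
    (if 1 \<le> x \<and> r = phase_state k (x - 1) then real k * mu else 0)"
proof -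
  obtain c d where r: "r = (c, d)"
    by (cases r)
  show ?thesis
  proof (cases "x = 0")
    case True
    have "(\<Sum>j=1..l. if r = phase_state k (x + k * j) then lam j else 0) =
        (\<Sum>j=1..l. if j = c then (if d = k then lam c else 0) else 0)"
      by (rule sum.cong) (auto simp: True r phase_state_mult[OF k])
    also have "\<dots> = (if d = k \<and> 1 \<le> c \<and> c \<le> l then lam c else 0)"
      by simp
    finally show ?thesis
      by (simp add: True r erlang_rate_def)
  next
    case False
    then have x: "x \<ge> 1"
      by simp
    obtain a b where ab: "phase_state k x = (a, b)"
      by (cases "phase_state k x")
    have "(\<Sum>j=1..l. if r = phase_state k (x + k * j) then lam j else 0) =
        (\<Sum>j=1..l. if j = c - a then (if d = b \<and> a < c then lam (c - a) else 0) else 0)"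
      by (rule sum.cong) (auto simp: r phase_state_add[OF k x ab])
    also have "\<dots> = (if d = b \<and> a < c \<and> c - a \<le> l then lam (c - a) else 0)"
      by auto
    finally show ?thesis
      using phase_state_bounds[OF k x ab] phase_state_pred[OF k x ab] x
      by (auto simp: r ab erlang_rate_def)
  qed
qed

text \<open>The map \<open>s\<close> may repeat a value, and the weights then add up. This happens
  in state 0, where the step -1 and the diagonal entry have the same target.\<close>

lemma infsum_finite_sum_delta:
  fixes f w :: "'a \<Rightarrow> real"
  assumes "finite J"
  shows "infsum (\<lambda>r. (\<Sum>j\<in>J. if r = s j then u j else 0) * f r) UNIV = (\<Sum>j\<in>J. u j * f (s j))"
proof -
  have "infsum (\<lambda>r. (\<Sum>j\<in>J. if r = s j then u j else 0) * f r) UNIV =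
      infsum (\<lambda>r. (\<Sum>j\<in>J. if r = s j then u j else 0) * f r) (s ` J)"
    by (rule infsum_cong_neutral) (auto intro!: sum.neutral)
  also have "\<dots> = (\<Sum>r\<in>s ` J. \<Sum>j\<in>J. if r = s j then u j * f r else 0)"
    using assms by (simp add: sum_distrib_right if_distrib[of "\<lambda>x. x * _"] cong: if_cong)
  also have "\<dots> = (\<Sum>j\<in>J. \<Sum>r\<in>s ` J. if r = s j then u j * f r else 0)"
    by (rule sum.swap)
  also have "\<dots> = (\<Sum>j\<in>J. u j * f (s j))"
    using assms by (intro sum.cong) auto
  finally show ?thesis .
qed

text \<open>The truncated subtraction \<open>x - 1\<close> builds the holding at 0 into the formula.
  Every row is then the step operator of one walk minus the same constant times the identity, which
  is what uniformisation requires.\<close>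

lemma erlang_gen_row:
  fixes lam :: "nat \<Rightarrow> real" and l :: nat
  assumes k: "k \<ge> 1"
  defines "L \<equiv> \<Sum>j=1..l. lam j"
  shows "infsum (\<lambda>r. erlang_gen k l mu lam (phase_state k x) r * f r) UNIV =
    (\<Sum>j=1..l. lam j * f (phase_state k (x + k * j))) + real k * mu * f (phase_state k (x - 1))
      - (L + real k * mu) * f (phase_state k x)"
proof -
  \<comment> \<open>Indices 0 and Suc l stand for the completion of a phase and for the diagonal entry.
    In state 0, where no phase can be completed, the two contributions cancel.\<close>
  define s where "s j = (if j = 0 then phase_state k (x - 1) else if j = Suc l then phase_state k x
      else phase_state k (x + k * j))" for j
  define u where "u j = (if j = 0 then real k * mu else if j = Suc l then - (L + real k * mu)
      else lam j)" for j
  have split: "(\<Sum>j\<in>{0..Suc l}. h j) = h 0 + (\<Sum>j=1..l. h j) + h (Suc l)" for h :: "nat \<Rightarrow> real"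
    by (simp add: sum.atLeast0_atMost_Suc_shift sum.atLeast_Suc_atMost)
  have rate: "erlang_rate k l mu lam (phase_state k x) r =
    (\<Sum>j=1..l. if r = s j then u j else 0) +
    (if 1 \<le> x \<and> r = phase_state k (x - 1) then real k * mu else 0)" for r
    unfolding erlang_rate_phase_state[OF k]
    by (intro arg_cong2[of _ _ _ _ "(+)"] sum.cong) (auto simp: s_def u_def)
  have diag: "erlang_rate k l mu lam (phase_state k x) (phase_state k x) = 0"
    using k by (auto simp: erlang_rate_phase_state intro!: sum.neutral)
  have tot: "infsum (\<lambda>r. if r = phase_state k x then 0 else erlang_rate k l mu lam (phase_state k x) r) UNIV
    = L + (if 1 \<le> x then real k * mu else 0)"
  proof -
    have "infsum (\<lambda>r. if r = phase_state k x then 0 else erlang_rate k l mu lam (phase_state k x) r) UNIV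
      = infsum (\<lambda>r. (\<Sum>j\<in>{0..l}. if r = s j then
          (if j = 0 then if 1 \<le> x then real k * mu else 0 else u j) else 0) * 1) UNIV"
    proof (rule infsum_cong)
      fix r
      show "(if r = phase_state k x then 0 else erlang_rate k l mu lam (phase_state k x) r) =
        (\<Sum>j\<in>{0..l}. if r = s j then
          (if j = 0 then if 1 \<le> x then real k * mu else 0 else u j) else 0) * 1"
      proof (cases "r = phase_state k x")
        case True
        then have "(\<Sum>j\<in>{0..l}. if r = s j then
            (if j = 0 then if 1 \<le> x then real k * mu else 0 else u j) else 0) = 0"
          using k by (intro sum.neutral) (auto simp: s_def)
        with True show ?thesis
          by simp
      next
        case False
        have "(\<Sum>j=1..l. if r = s j then u j else 0) = (\<Sum>j=1..l. if r = s j then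
          (if j = 0 then if 1 \<le> x then real k * mu else 0 else u j) else 0)"
          by (rule sum.cong) auto
        then show ?thesis
          using False by (simp add: rate sum.atLeast_Suc_atMost s_def[of 0])
      qed
    qed
    also have "\<dots> = (\<Sum>j\<in>{0..l}. if j = 0 then if 1 \<le> x then real k * mu else 0 else u j)"
      by (subst infsum_finite_sum_delta) auto
    also have "\<dots> = (\<Sum>j=1..l. lam j) + (if 1 \<le> x then real k * mu else 0)"
      by (simp add: sum.atLeast_Suc_atMost u_def)
    finally show ?thesis
      by (simp add: L_def)
  qed
  have "erlang_gen k l mu lam (phase_state k x) r = (\<Sum>j\<in>{0..Suc l}. if r = s j then u j else 0)" for r
  proof (cases "r = phase_state k x")
    case True
    have 1: "(\<Sum>j=1..l. if r = s j then u j else 0) = 0"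
      using True k by (auto simp: s_def intro!: sum.neutral)
    show ?thesis
      using True tot k unfolding split 1 apply -
      by (auto simp: erlang_gen_def s_def u_def)
  next
    case False
    then have "erlang_gen k l mu lam (phase_state k x) r = erlang_rate k l mu lam (phase_state k x) r"
      by (simp add: erlang_gen_def)
    with False show ?thesis
      unfolding split rate by (cases "x = 0") (auto simp: s_def[of 0] s_def[of "Suc l"] u_def[of 0])
  qed
  then have "infsum (\<lambda>r. erlang_gen k l mu lam (phase_state k x) r * f r) UNIV =
      (\<Sum>j\<in>{0..Suc l}. u j * f (s j))"
    by (simp only:) (rule infsum_finite_sum_delta, simp)
  also have "\<dots> = (\<Sum>j=1..l. u j * f (s j)) + u 0 * f (s 0) + u (Suc l) * f (s (Suc l))"
    unfolding split by simp
  also have "(\<Sum>j=1..l. u j * f (s j)) = (\<Sum>j=1..l. lam j * f (phase_state k (x + k * j)))"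
    by (rule sum.cong) (auto simp: s_def u_def)
  finally show ?thesis
    by (simp add: s_def u_def algebra_simps)
qed

section \<open>Weights of the reflected walk\<close>

text \<open>The generating polynomial of a single step of the uniformised walk of remaining phases,
  multiplied by the variable so that the step -1 becomes the constant term.\<close>

definition step_poly :: "nat \<Rightarrow> nat \<Rightarrow> real \<Rightarrow> (nat \<Rightarrow> real) \<Rightarrow> real poly" where
  "step_poly k l a lam = [:a:] + (\<Sum>j=1..l. monom (lam j) (Suc (k * j)))"

text \<open>By the hitting time theorem, the coefficient of this polynomial at N + 1 - h is the total
  weight of the free paths of length N + 1 that hit -h for the first time in their last step.\<close>

definition hit_poly :: "nat \<Rightarrow> nat \<Rightarrow> real \<Rightarrow> (nat \<Rightarrow> real) \<Rightarrow> nat \<Rightarrow> real poly" where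
  "hit_poly k l a lam N = step_poly k l a lam ^ N *
    (step_poly k l a lam - [:0, 1:] * pderiv (step_poly k l a lam))"

text \<open>The total weight of the paths of length N from x to 0 of the walk that is kept at 0 by a
  step -1.\<close>

definition walk_weight :: "nat \<Rightarrow> nat \<Rightarrow> real \<Rightarrow> (nat \<Rightarrow> real) \<Rightarrow> nat \<Rightarrow> nat \<Rightarrow> real" where
  "walk_weight k l a lam N x = (\<Sum>i<Suc N - x. coeff (hit_poly k l a lam N) i) / a"

lemma coeff_X_pderiv: "coeff ([:0, 1:] * pderiv p) i = of_nat i * coeff p i"
  for p :: "'a::{comm_semiring_1,semiring_no_zero_divisors} poly"
  by (cases i) (simp_all add: coeff_pCons coeff_pderiv)

text \<open>With \<open>P\<close> the step polynomial, \<open>(N + 1) P^N (P - X P')\<close> equals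
  \<open>(N + 1) P^(N + 1) - X (P^(N + 1))'\<close>, and \<open>X\<close> times the derivative
  multiplies the i-th coefficient by i. At \<open>i = N + 1 - h\<close> the factor is the
  \<open>h / (N + 1)\<close> of the hitting time theorem.\<close>

lemma coeff_hit_poly:
  "coeff (hit_poly k l a lam N) i =
    (real (Suc N) - real i) / real (Suc N) * coeff (step_poly k l a lam ^ Suc N) i"
proof -
  let ?P = "step_poly k l a lam"
  have "smult (real (Suc N)) (hit_poly k l a lam N) =
      smult (real (Suc N)) (?P ^ Suc N) - [:0, 1:] * pderiv (?P ^ Suc N)"
    unfolding hit_poly_def pderiv_power_Suc
    by (simp add: algebra_simps smult_diff_right del: mult_pCons_left power_Suc) (simp add: mult_ac)
  from arg_cong[OF this, of "\<lambda>p. coeff p i"]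
  have "real (Suc N) * coeff (hit_poly k l a lam N) i =
      (real (Suc N) - real i) * coeff (?P ^ Suc N) i"
    unfolding coeff_diff coeff_smult coeff_X_pderiv by (simp add: algebra_simps)
  then show ?thesis
    by (simp add: field_simps)
qed

lemma sum_coeff_monom_mult:
  "(\<Sum>i<M. coeff (monom c n * p) i) = c * (\<Sum>i<M - n. coeff p i)"
  for c :: "'a::comm_semiring_1"
proof (induction M)
  case (Suc M)
  then show ?case
    by (cases "n \<le> M") (simp_all add: coeff_monom_mult Suc_diff_le distrib_left)
qed simp

lemma sum_coeff_step_poly_mult:
  "(\<Sum>i<M. coeff (step_poly k l a lam * p) i) =
    a * (\<Sum>i<M. coeff p i) + (\<Sum>j=1..l. lam j * (\<Sum>i<M - Suc (k * j). coeff p i))"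
proof -
  have "(\<Sum>i<M. coeff (step_poly k l a lam * p) i) =
      a * (\<Sum>i<M. coeff p i) + (\<Sum>i<M. \<Sum>j=1..l. coeff (monom (lam j) (Suc (k * j)) * p) i)"
    by (simp add: step_poly_def distrib_right sum_distrib_right coeff_sum sum.distrib sum_distrib_left)
  also have "(\<Sum>i<M. \<Sum>j=1..l. coeff (monom (lam j) (Suc (k * j)) * p) i) =
      (\<Sum>j=1..l. lam j * (\<Sum>i<M - Suc (k * j). coeff p i))"
    by (subst sum.swap) (simp only: sum_coeff_monom_mult)
  finally show ?thesis .
qed

lemma walk_weight_0:
  assumes "a > 0"
  shows "walk_weight k l a lam 0 x = (if x = 0 then 1 else 0)"
proof (cases x)
  case 0
  have "coeff (step_poly k l a lam) 0 = a"
    by (simp add: step_poly_def coeff_sum)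
  then show ?thesis
    using assms 0 by (simp add: walk_weight_def coeff_hit_poly)
qed (simp add: walk_weight_def)

text \<open>The factor \<open>P - X P'\<close> of \<open>hit_poly\<close> does not depend on
  \<open>N\<close>, so passing to \<open>N + 1\<close> multiplies by \<open>step_poly\<close>, whose
  monomials are the single steps. Multiplying by a monomial shifts the range of a partial sum of
  coefficients, that is, the starting point of the walk.\<close>

lemma walk_weight_Suc:
  assumes "a > 0"
  shows "walk_weight k l a lam (Suc N) x =
    a * walk_weight k l a lam N (x - 1) + (\<Sum>j=1..l. lam j * walk_weight k l a lam N (x + k * j))"
proof -
  let ?F = "\<lambda>M. \<Sum>i<M. coeff (hit_poly k l a lam N) i"
  have "hit_poly k l a lam (Suc N) = step_poly k l a lam * hit_poly k l a lam N"
    by (simp add: hit_poly_def mult.assoc)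
  then have "walk_weight k l a lam (Suc N) x =
      (a * ?F (Suc (Suc N) - x) + (\<Sum>j=1..l. lam j * ?F (Suc (Suc N) - x - Suc (k * j)))) / a"
    unfolding walk_weight_def by (simp only: sum_coeff_step_poly_mult)
  \<comment> \<open>For \<open>x >= 1\<close> the two ranges coincide. For \<open>x = 0\<close> the
    left one has the additional index \<open>Suc N\<close>, where the factor
    \<open>N + 1 - i\<close> of the coefficient is 0: this is the holding at 0.\<close>
  also have "?F (Suc (Suc N) - x) = ?F (Suc N - (x - 1))"
    by (cases x) (simp_all add: coeff_hit_poly)
  also have "(\<Sum>j=1..l. lam j * ?F (Suc (Suc N) - x - Suc (k * j))) =
      (\<Sum>j=1..l. lam j * ?F (Suc N - (x + k * j)))"
    by (simp add: diff_diff_left)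
  finally show ?thesis
    unfolding walk_weight_def by (simp add: add_divide_distrib sum_divide_distrib[of _ "{Suc 0..l}"])
qed

lemma walk_weight_nonneg:
  assumes "a > 0" "\<And>j. j \<in> {1..l} \<Longrightarrow> lam j \<ge> 0"
  shows "walk_weight k l a lam N x \<ge> 0"
proof (induction N arbitrary: x)
  case (Suc N)
  then show ?case
    unfolding walk_weight_Suc[OF assms(1)]
    using assms by (intro add_nonneg_nonneg mult_nonneg_nonneg sum_nonneg) auto
qed (simp add: walk_weight_0 assms(1))

lemma walk_weight_le:
  assumes "a > 0" "\<And>j. j \<in> {1..l} \<Longrightarrow> lam j \<ge> 0"
  shows "walk_weight k l a lam N x \<le> ((\<Sum>j=1..l. lam j) + a) ^ N"
proof (induction N arbitrary: x)
  case (Suc N)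
  let ?c = "((\<Sum>j=1..l. lam j) + a) ^ N"
  have "walk_weight k l a lam (Suc N) x \<le> a * ?c + (\<Sum>j=1..l. lam j * ?c)"
    unfolding walk_weight_Suc[OF assms(1)]
    using assms Suc by (intro add_mono mult_left_mono sum_mono) auto
  then show ?case
    by (simp add: algebra_simps sum_distrib_right)
qed (simp add: walk_weight_0 assms(1))

section \<open>Uniformisation: from walk weights to the transition function\<close>

lemma binomial_sum_Suc:
  fixes a :: "'a::comm_semiring_1"
  shows "(\<Sum>i\<le>Suc N. of_nat (Suc N choose i) * a ^ (Suc N - i) * w i) =
    (\<Sum>i\<le>N. of_nat (N choose i) * a ^ (N - i) * w (Suc i)) +
    a * (\<Sum>i\<le>N. of_nat (N choose i) * a ^ (N - i) * w i)"
proof -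
  have "a * (\<Sum>i\<le>N. of_nat (N choose i) * a ^ (N - i) * w i) =
      (\<Sum>i\<le>Suc N. of_nat (N choose i) * a ^ (Suc N - i) * w i)"
    by (simp add: sum_distrib_left Suc_diff_le mult_ac binomial_eq_0)
  also have "\<dots> = a ^ Suc N * w 0 + (\<Sum>i\<le>N. of_nat (N choose Suc i) * a ^ (N - i) * w (Suc i))"
    unfolding sum.atMost_Suc_shift by simp
  finally show ?thesis
    unfolding sum.atMost_Suc_shift by (simp add: algebra_simps sum.distrib)
qed

text \<open>The generator is the step operator of the walk minus \<open>c\<close> times the
  identity, and the two commute, so its powers follow the binomial theorem. In the induction the
  recursion of the walk supplies the shift of the index \<open>i\<close>, and
  \<open>binomial_sum_Suc\<close> is Pascal's rule for shift plus constant.\<close>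

lemma erlang_gen_pow_phase_state:
  assumes "k \<ge> 1" "mu > 0"
  defines "a \<equiv> real k * mu"
  shows "erlang_gen_pow k l mu lam N (phase_state k x) (0, 0) =
    (\<Sum>i\<le>N. of_nat (N choose i) * (- ((\<Sum>j=1..l. lam j) + a)) ^ (N - i) * walk_weight k l a lam i x)"
proof (induction N arbitrary: x)
  case 0
  have "a > 0"
    using assms by simp
  moreover have "phase_state k x = (0, 0) \<longleftrightarrow> x = 0"
    by (metis phase_state_0 phase_state_eq_iff)
  ultimately show ?case
    by (simp add: walk_weight_0)
next
  case (Suc N)
  have a: "a > 0"
    using assms by simp
  let ?c = "(\<Sum>j=1..l. lam j) + a"
  let ?B = "\<lambda>w. \<Sum>i\<le>N. of_nat (N choose i) * (- ?c) ^ (N - i) * w i"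
  have lin: "(\<Sum>j=1..l. lam j * ?B (\<lambda>i. walk_weight k l a lam i (x + k * j))) +
      a * ?B (\<lambda>i. walk_weight k l a lam i (x - 1)) = ?B (\<lambda>i. walk_weight k l a lam (Suc i) x)"
    unfolding walk_weight_Suc[OF a]
    by (simp add: sum_distrib_left sum.swap[of _ "{Suc 0..l}"] sum.distrib algebra_simps)
  have "erlang_gen_pow k l mu lam (Suc N) (phase_state k x) (0, 0) =
      (\<Sum>j=1..l. lam j * ?B (\<lambda>i. walk_weight k l a lam i (x + k * j))) +
      a * ?B (\<lambda>i. walk_weight k l a lam i (x - 1)) - ?c * ?B (\<lambda>i. walk_weight k l a lam i x)"
    using erlang_gen_row[OF assms(1), of l mu lam x "\<lambda>r. erlang_gen_pow k l mu lam N r (0, 0)"]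
    by (simp add: Suc a_def)
  then show ?case
    unfolding lin binomial_sum_Suc by (simp only: mult_minus_left diff_conv_add_uminus)
qed

text \<open>The Cauchy product of the series of \<open>exp (- c * t)\<close> and of the weights
  turns the binomial sums into the power series that defines \<open>erlang_trans\<close>. Absolute
  convergence holds because the steps have total weight \<open>c\<close>, so that the weights are at
  most \<open>c ^ N\<close>.\<close>

lemma
  assumes "k \<ge> 1" "mu > 0" "\<And>j. j \<in> {1..l} \<Longrightarrow> lam j \<ge> 0"
  defines "a \<equiv> real k * mu"
  defines "c \<equiv> (\<Sum>j=1..l. lam j) + a"
  shows summable_walk_weight: "summable (\<lambda>N. norm (t ^ N / fact N * walk_weight k l a lam N 0))"
    and erlang_trans_walk_weight: "erlang_trans k l mu lam t (0, 0) (0, 0) =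
      exp (- c * t) * (\<Sum>N. t ^ N / fact N * walk_weight k l a lam N 0)"
proof -
  have a: "a > 0"
    using assms by simp
  let ?w = "\<lambda>N. t ^ N / fact N * walk_weight k l a lam N 0"
  show sm: "summable (\<lambda>N. norm (?w N))"
  proof (rule summable_comparison_test')
    show "summable (\<lambda>N. (\<bar>t\<bar> * c) ^ N /\<^sub>R fact N)"
      by (rule summable_exp_generic)
    show "norm (norm (?w N)) \<le> (\<bar>t\<bar> * c) ^ N /\<^sub>R fact N" if "N \<ge> 0" for N
    proof -
      have "norm (?w N) = (\<bar>t\<bar> ^ N / fact N) * walk_weight k l a lam N 0"
        using walk_weight_nonneg[OF a, where lam=lam] assms by (simp add: abs_mult power_abs)
      also have "\<dots> \<le> (\<bar>t\<bar> ^ N / fact N) * c ^ N"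
        unfolding c_def using assms by (intro mult_left_mono walk_weight_le[OF a]) auto
      finally show ?thesis
        by (simp add: power_mult_distrib field_simps)
    qed
  qed
  let ?e = "\<lambda>N. (- c * t) ^ N / fact N"
  have "summable (\<lambda>N. norm (?e N))"
    using summable_norm_exp[of "- c * t"] by (simp add: field_simps)
  from Cauchy_product_sums[OF sm this]
  have "(\<lambda>N. \<Sum>i\<le>N. ?w i * ?e (N - i)) sums ((\<Sum>N. ?w N) * (\<Sum>N. ?e N))" .
  moreover have "(\<Sum>i\<le>N. ?w i * ?e (N - i)) =
      t ^ N / fact N * erlang_gen_pow k l mu lam N (0, 0) (0, 0)" for N
  proof -
    have "?w i * ?e (N - i) = t ^ N / fact N *
        (of_nat (N choose i) * (- c) ^ (N - i) * walk_weight k l a lam i 0)" if "i \<le> N" for i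
    proof -
      have "(- c * t) ^ (N - i) = (- c) ^ (N - i) * t ^ (N - i)" "t ^ N = t ^ i * t ^ (N - i)"
        using that by (simp_all only: power_mult_distrib power_add[symmetric] le_add_diff_inverse)
      then show ?thesis
        using that by (simp add: binomial_fact field_simps)
    qed
    then show ?thesis
      using erlang_gen_pow_phase_state[OF assms(1,2), of l lam N 0]
      by (simp add: sum_distrib_left c_def a_def)
  qed
  moreover have "(\<Sum>N. ?e N) = exp (- c * t)"
    using exp_converges[of "- c * t"] by (simp add: sums_iff field_simps)
  ultimately show "erlang_trans k l mu lam t (0, 0) (0, 0) = exp (- c * t) * (\<Sum>N. ?w N)"
    unfolding erlang_trans_def by (simp add: sums_iff mult.commute)
qed

section \<open>The zero state probability of the queue\<close>

lemma multi_idx_0: "multi_idx 0 n = (if n = 0 then {\<lambda>_. 0} else {})"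
  by (auto simp: multi_idx_def)

lemma multi_idx_Suc:
  "multi_idx (Suc l) n = (\<lambda>(i, m). m(Suc l := n - i)) ` (SIGMA i:{..n}. multi_idx l i)"
proof (intro equalityI subsetI)
  fix m assume m: "m \<in> multi_idx (Suc l) n"
  define i where "i = (\<Sum>j=1..l. m j)"
  have "i + m (Suc l) = n"
    using m by (simp add: multi_idx_def i_def)
  moreover have "(\<Sum>j=1..l. (m(Suc l := 0)) j) = i"
    unfolding i_def by (rule sum.cong) auto
  then have "m(Suc l := 0) \<in> multi_idx l i"
    using m by (auto simp: multi_idx_def)
  moreover have "m = (m(Suc l := 0))(Suc l := n - i)"
    using \<open>i + m (Suc l) = n\<close> by (auto simp: fun_eq_iff)
  ultimately show "m \<in> (\<lambda>(i, m). m(Suc l := n - i)) ` (SIGMA i:{..n}. multi_idx l i)"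
    by (intro image_eqI[of _ _ "(i, m(Suc l := 0))"]) auto
next
  fix m assume "m \<in> (\<lambda>(i, m). m(Suc l := n - i)) ` (SIGMA i:{..n}. multi_idx l i)"
  then obtain i m' where m: "m = m'(Suc l := n - i)" "i \<le> n" "m' \<in> multi_idx l i"
    by auto
  have "(\<Sum>j=1..l. m j) = (\<Sum>j=1..l. m' j)"
    by (rule sum.cong) (auto simp: m)
  then show "m \<in> multi_idx (Suc l) n"
    using m by (auto simp: multi_idx_def)
qed

lemma finite_multi_idx [simp]: "finite (multi_idx l n)"
  by (induction l arbitrary: n) (simp_all add: multi_idx_0 multi_idx_Suc)

lemma sum_multi_idx_Suc:
  fixes d :: "nat \<Rightarrow> nat \<Rightarrow> 'a::comm_semiring_1"
  shows "(\<Sum>m\<in>multi_idx (Suc l) n. \<Prod>j=1..Suc l. d j (m j)) =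
    (\<Sum>i\<le>n. (\<Sum>m\<in>multi_idx l i. \<Prod>j=1..l. d j (m j)) * d (Suc l) (n - i))"
proof -
  have inj: "inj_on (\<lambda>(i, m). m(Suc l := n - i)) (SIGMA i:{..n}. multi_idx l i)"
  proof (rule inj_onI, clarsimp)
    fix i m i' m'
    assume *: "i \<le> n" "m \<in> multi_idx l i" "i' \<le> n" "m' \<in> multi_idx l i'"
      and eq: "m(Suc l := n - i) = m'(Suc l := n - i')"
    from fun_cong[OF eq, of "Suc l"] have "i = i'"
      using * by simp
    moreover have "m j = m' j" for j
      using fun_cong[OF eq, of j] * by (cases "j = Suc l") (auto simp: multi_idx_def)
    ultimately show "i = i' \<and> m = m'"
      by auto
  qed
  have "(\<Sum>m\<in>multi_idx (Suc l) n. \<Prod>j=1..Suc l. d j (m j)) =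
      (\<Sum>(i, m)\<in>(SIGMA i:{..n}. multi_idx l i). \<Prod>j=1..Suc l. d j ((m(Suc l := n - i)) j))"
    unfolding multi_idx_Suc by (subst sum.reindex[OF inj]) (auto simp: case_prod_beta intro!: sum.cong)
  also have "\<dots> = (\<Sum>(i, m)\<in>(SIGMA i:{..n}. multi_idx l i). (\<Prod>j=1..l. d j (m j)) * d (Suc l) (n - i))"
  proof (intro sum.cong refl, clarify)
    fix i m
    have "(\<Prod>j=1..l. d j ((m(Suc l := n - i)) j)) = (\<Prod>j=1..l. d j (m j))"
      by (rule prod.cong) auto
    then show "(\<Prod>j=1..Suc l. d j ((m(Suc l := n - i)) j)) = (\<Prod>j=1..l. d j (m j)) * d (Suc l) (n - i)"
      by simp
  qed
  also have "\<dots> = (\<Sum>i\<le>n. \<Sum>m\<in>multi_idx l i. (\<Prod>j=1..l. d j (m j)) * d (Suc l) (n - i))"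
    by (subst sum.Sigma) auto
  finally show ?thesis
    by (simp add: sum_distrib_right)
qed

text \<open>Divided by factorials, the binomial theorem is a convolution, and so is a sum over
  multi-indices when its last coordinate is split off. The induction on \<open>l\<close> matches the
  two.\<close>

lemma multinomial_poly:
  fixes y :: "nat \<Rightarrow> 'a::field_char_0 poly"
  shows "smult (1 / fact n) ((\<Sum>j=1..l. y j) ^ n) =
    (\<Sum>m\<in>multi_idx l n. \<Prod>j=1..l. smult (1 / fact (m j)) (y j ^ m j))"
proof (induction l arbitrary: n)
  case 0
  then show ?case
    by (cases n) (simp_all add: multi_idx_0)
next
  case (Suc l)
  have smult_sum: "smult c (sum f A) = (\<Sum>i\<in>A. smult c (f i))" for c :: 'a and f and A :: "nat set"
    by (induction A rule: infinite_finite_induct) (simp_all add: smult_add_right)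
  have "smult (1 / fact n) ((\<Sum>j=1..Suc l. y j) ^ n) =
      (\<Sum>i\<le>n. smult (1 / fact n) (of_nat (n choose i) * (\<Sum>j=1..l. y j) ^ i * y (Suc l) ^ (n - i)))"
    by (simp add: binomial_ring smult_sum)
  also have "\<dots> = (\<Sum>i\<le>n. smult (1 / fact i) ((\<Sum>j=1..l. y j) ^ i) *
      smult (1 / fact (n - i)) (y (Suc l) ^ (n - i)))"
  proof (rule sum.cong)
    fix i assume "i \<in> {..n}"
    then have "1 / fact n * of_nat (n choose i) = 1 / fact i * (1 / fact (n - i) :: 'a)"
      by (simp add: binomial_fact)
    then show "smult (1 / fact n) (of_nat (n choose i) * (\<Sum>j=1..l. y j) ^ i * y (Suc l) ^ (n - i)) =
        smult (1 / fact i) ((\<Sum>j=1..l. y j) ^ i) * smult (1 / fact (n - i)) (y (Suc l) ^ (n - i))"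
      by (simp add: of_nat_poly mult_ac)
  qed simp
  also have "\<dots> = (\<Sum>m\<in>multi_idx (Suc l) n. \<Prod>j=1..Suc l. smult (1 / fact (m j)) (y j ^ m j))"
    unfolding Suc by (rule sum_multi_idx_Suc[where d = "\<lambda>j i. smult (1 / fact i) (y j ^ i)", symmetric])
  finally show ?case .
qed

lemma prod_monom: "(\<Prod>j\<in>A. monom (u j) (e j)) = monom (\<Prod>j\<in>A. u j) (\<Sum>j\<in>A. e j)"
  for u :: "'b \<Rightarrow> 'a::comm_semiring_1"
  by (induction A rule: infinite_finite_induct) (simp_all add: mult_monom monom_0)

text \<open>Among \<open>N\<close> steps, \<open>n\<close> are arrivals, with \<open>m j\<close>
  batches of size \<open>j\<close>, and the other \<open>N - n\<close> are services of weight
  \<open>a\<close>. A batch of size \<open>j\<close> has exponent \<open>k * j + 1\<close>, so the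
  total exponent is \<open>n\<close> plus \<open>k\<close> times the number of customers.\<close>

lemma coeff_step_poly_power:
  "coeff (step_poly k l a lam ^ N) i = (\<Sum>n\<le>N. fact N / fact (N - n) * a ^ (N - n) *
    (\<Sum>m\<in>multi_idx l n. if n + k * (\<Sum>j=1..l. j * m j) = i
      then \<Prod>j=1..l. lam j ^ m j / fact (m j) else 0))"
proof -
  let ?S = "\<Sum>j=1..l. monom (lam j) (Suc (k * j))"
  have S: "coeff (?S ^ n) i = fact n *
    (\<Sum>m\<in>multi_idx l n. if n + k * (\<Sum>j=1..l. j * m j) = i
      then \<Prod>j=1..l. lam j ^ m j / fact (m j) else 0)" for n
  proof -
    have "coeff (?S ^ n) i = fact n * coeff (smult (1 / fact n) (?S ^ n)) i"
      by simp
    also have "smult (1 / fact n) (?S ^ n) =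
        (\<Sum>m\<in>multi_idx l n. monom (\<Prod>j=1..l. lam j ^ m j / fact (m j)) (\<Sum>j=1..l. Suc (k * j) * m j))"
      unfolding multinomial_poly by (simp add: monom_power smult_monom prod_monom)
    also have "\<dots> = (\<Sum>m\<in>multi_idx l n. monom (\<Prod>j=1..l. lam j ^ m j / fact (m j))
        (n + k * (\<Sum>j=1..l. j * m j)))"
      by (intro sum.cong refl arg_cong2[of _ _ _ _ monom])
        (simp add: multi_idx_def sum.distrib sum_distrib_left mult_ac)
    finally show ?thesis
      by (simp add: coeff_sum coeff_monom del: One_nat_def)
  qed
  have "step_poly k l a lam ^ N = (\<Sum>n\<le>N. of_nat (N choose n) * ?S ^ n * [:a:] ^ (N - n))"
    unfolding step_poly_def by (subst add.commute) (rule binomial_ring)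
  also have "\<dots> = (\<Sum>n\<le>N. smult (of_nat (N choose n) * a ^ (N - n)) (?S ^ n))"
    by (intro sum.cong) (simp_all add: of_nat_poly poly_const_pow mult_ac)
  finally have "coeff (step_poly k l a lam ^ N) i =
      (\<Sum>n\<le>N. of_nat (N choose n) * a ^ (N - n) * coeff (?S ^ n) i)"
    by (simp add: coeff_sum)
  also have "\<dots> = (\<Sum>n\<le>N. fact N / fact (N - n) * a ^ (N - n) *
    (\<Sum>m\<in>multi_idx l n. if n + k * (\<Sum>j=1..l. j * m j) = i
      then \<Prod>j=1..l. lam j ^ m j / fact (m j) else 0))"
    unfolding S by (intro sum.cong) (simp_all add: binomial_fact)
  finally show ?thesis .
qed

text \<open>The condition on \<open>gamma0\<close> says that g is the length \<open>N + 1\<close> of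
  the free path, with \<open>g - n\<close> services. The hitting factor \<open>h / (N + 1)\<close>
  turns the factorial of \<open>N + 1\<close> into \<open>h\<close> times that of
  \<open>g - 1\<close>, and the division by \<open>a\<close> leaves \<open>g - n - 1\<close> factors
  \<open>k * mu\<close>. The index \<open>h\<close> starts at 0 here, hence
  \<open>Suc h\<close>.\<close>

lemma walk_weight_expansion:
  assumes "k \<ge> 1" "mu > 0" "(\<Sum>j=1..l. lam j) > 0"
  defines "Lam \<equiv> \<Sum>j=1..l. lam j"
  shows "walk_weight k l (real k * mu) lam N 0 = (\<Sum>h\<le>N. \<Sum>n\<le>Suc N. \<Sum>m\<in>multi_idx l n.
    if gamma0 k l (Suc h) n m = Suc N then C0 k l mu Lam (\<lambda>j. lam j / Lam) (Suc h) n m else 0)"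
proof -
  define a where "a = real k * mu"
  have a: "a > 0"
    using assms by (simp add: a_def)
  let ?P = "\<lambda>m. \<Prod>j=1..l. lam j ^ m j / fact (m j)"
  let ?K = "\<lambda>m. k * (\<Sum>j=1..l. j * m j)"
  have "walk_weight k l a lam N 0 = (\<Sum>h\<le>N. coeff (hit_poly k l a lam N) (N - h) / a)"
    unfolding walk_weight_def
    using sum.nat_diff_reindex[of "\<lambda>i. coeff (hit_poly k l a lam N) i / a" "Suc N"]
    by (simp add: sum_divide_distrib lessThan_Suc_atMost)
  also have "\<dots> = (\<Sum>h\<le>N. \<Sum>n\<le>Suc N. \<Sum>m\<in>multi_idx l n.
    if gamma0 k l (Suc h) n m = Suc N then C0 k l mu Lam (\<lambda>j. lam j / Lam) (Suc h) n m else 0)"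
  proof (rule sum.cong[OF refl])
    fix h assume h: "h \<in> {..N}"
    have "coeff (hit_poly k l a lam N) (N - h) / a =
      (\<Sum>n\<le>Suc N. \<Sum>m\<in>multi_idx l n. real (Suc h) / real (Suc N) * (fact (Suc N) / fact (Suc N - n)) *
        (a ^ (Suc N - n) / a) * (if n + ?K m = N - h then ?P m else 0))"
    proof -
      have "real (Suc N) - real (N - h) = real (Suc h)"
        using h by (simp add: of_nat_diff)
      then show ?thesis
        unfolding coeff_hit_poly coeff_step_poly_power
        by (simp only: sum_distrib_left sum_divide_distrib) (simp add: mult_ac del: One_nat_def fact_Suc)
    qed
    also have "\<dots> = (\<Sum>n\<le>Suc N. \<Sum>m\<in>multi_idx l n.
      if gamma0 k l (Suc h) n m = Suc N then C0 k l mu Lam (\<lambda>j. lam j / Lam) (Suc h) n m else 0)"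
    proof (intro sum.cong refl)
      fix n m assume n: "n \<in> {..Suc N}" and m: "m \<in> multi_idx l n"
      have iff: "n + ?K m = N - h \<longleftrightarrow> gamma0 k l (Suc h) n m = Suc N"
        using h by (auto simp: gamma0_def)
      show "real (Suc h) / real (Suc N) * (fact (Suc N) / fact (Suc N - n)) * (a ^ (Suc N - n) / a) *
        (if n + ?K m = N - h then ?P m else 0) =
        (if gamma0 k l (Suc h) n m = Suc N then C0 k l mu Lam (\<lambda>j. lam j / Lam) (Suc h) n m else 0)"
      proof (cases "gamma0 k l (Suc h) n m = Suc N")
        case True
        then have "n \<le> N"
          by (simp add: gamma0_def)
        then have "a ^ (Suc N - n) / a = a ^ (N - n)"
          using a by (simp add: Suc_diff_le)
        moreover have "Lam ^ n * (\<Prod>j=1..l. (lam j / Lam) ^ m j / fact (m j)) = ?P m"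
        proof -
          have "Lam ^ n = (\<Prod>j=1..l. Lam ^ m j)"
            using m by (simp add: multi_idx_def power_sum[symmetric])
          then have "Lam ^ n * (\<Prod>j=1..l. (lam j / Lam) ^ m j / fact (m j)) =
              (\<Prod>j=1..l. Lam ^ m j * ((lam j / Lam) ^ m j / fact (m j)))"
            by (simp only: prod.distrib)
          also have "\<dots> = ?P m"
            using assms by (intro prod.cong) (auto simp: Lam_def power_divide)
          finally show ?thesis .
        qed
        moreover have "C0 k l mu Lam (\<lambda>j. lam j / Lam) (Suc h) n m = real (Suc h) *
            (Lam ^ n * (\<Prod>j=1..l. (lam j / Lam) ^ m j / fact (m j))) * a ^ (N - n) /
            fact (Suc N - n) * fact N"
          unfolding C0_def Let_def True by (simp add: a_def)
        moreover have "real (Suc h) / real (Suc N) * (fact (Suc N) / D) * A * P =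
            real (Suc h) * P * A / D * fact N" for D A P :: real
          by (simp add: mult_ac del: of_nat_Suc)
        ultimately show ?thesis
          unfolding iff if_P[OF True] by (simp only:)
      qed (simp only: iff if_False mult_zero_right)
    qed
    finally show "coeff (hit_poly k l a lam N) (N - h) / a = \<dots>" .
  qed
  finally show ?thesis
    by (simp add: a_def)
qed

section \<open>Regrouping the series by h, n and m\<close>

lemma suminf_swap_ennreal: "(\<Sum>i. \<Sum>j. f i j) = (\<Sum>j. \<Sum>i. f i j)"
  for f :: "nat \<Rightarrow> nat \<Rightarrow> ennreal"
  using nn_integral_suminf[of "\<lambda>j i. f i j" "count_space UNIV"]
  by (simp add: nn_integral_count_space_nat)

lemma gamma0_ge: "h + n \<le> gamma0 k l h n m"
  by (simp add: gamma0_def)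

lemma C0_nonneg:
  assumes "mu > 0" "\<And>j. j \<in> {1..l} \<Longrightarrow> lam j \<ge> 0" "Lam \<ge> 0"
  shows "C0 k l mu Lam (\<lambda>j. lam j / Lam) h n m \<ge> 0"
  unfolding C0_def Let_def using assms
  by (intro mult_nonneg_nonneg divide_nonneg_nonneg prod_nonneg) auto

text \<open>Every triple h, n, m belongs to exactly one path length, \<open>N = g - 1\<close>. All
  terms are nonnegative, so in \<open>ennreal\<close> the sum over \<open>N\<close> can be moved
  inwards until only this term is left.\<close>

lemma erlang_trans_zero_expansion:
  assumes "k \<ge> 1" "l \<ge> 1" "mu > 0" "\<And>j. j \<in> {1..l} \<Longrightarrow> lam j > 0" "t \<ge> 0"
  defines "Lam \<equiv> \<Sum>j=1..l. lam j"
  shows "ennreal (erlang_trans k l mu lam t (0, 0) (0, 0)) =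
    (\<Sum>h. \<Sum>n. \<Sum>m\<in>multi_idx l n. let g = gamma0 k l (Suc h) n m in
      ennreal (C0 k l mu Lam (\<lambda>j. lam j / Lam) (Suc h) n m *
        (t ^ (g - 1) * exp (- (Lam + real k * mu) * t) / fact (g - 1))))"
proof -
  have lam: "lam j \<ge> 0" if "j \<in> {1..l}" for j
    using assms(4)[OF that] by simp
  have Lam: "Lam > 0"
    unfolding Lam_def using assms by (intro sum_pos) auto
  let ?c = "Lam + real k * mu" and ?e = "exp (- (Lam + real k * mu) * t)"
  let ?C = "\<lambda>h n m. C0 k l mu Lam (\<lambda>j. lam j / Lam) (Suc h) n m"
  let ?g = "\<lambda>h n m. gamma0 k l (Suc h) n m"
  let ?T = "\<lambda>h n m. ennreal (?C h n m * (t ^ (?g h n m - 1) * ?e / fact (?g h n m - 1)))"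
  have C: "?C h n m \<ge> 0" for h n m
    using assms lam Lam by (intro C0_nonneg) auto
  let ?w = "\<lambda>N. walk_weight k l (real k * mu) lam N 0"
  have w: "?w N \<ge> 0" for N
    using assms lam by (intro walk_weight_nonneg) auto
  have expansion: "ennreal (?e * (t ^ N / fact N * ?w N)) =
      (\<Sum>h. \<Sum>n. \<Sum>m\<in>multi_idx l n. if ?g h n m = Suc N then ?T h n m else 0)" for N
  proof -
    have "ennreal (?e * (t ^ N / fact N * ?w N)) = ennreal (\<Sum>h\<le>N. \<Sum>n\<le>Suc N. \<Sum>m\<in>multi_idx l n.
        if ?g h n m = Suc N then ?C h n m * (t ^ (?g h n m - 1) * ?e / fact (?g h n m - 1)) else 0)"
      unfolding walk_weight_expansion[OF assms(1,3) Lam[unfolded Lam_def], folded Lam_def] sum_distrib_left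
      by (intro arg_cong[of _ _ ennreal] sum.cong refl) (simp del: fact_Suc)
    also have "\<dots> = (\<Sum>h\<le>N. \<Sum>n\<le>Suc N. \<Sum>m\<in>multi_idx l n. if ?g h n m = Suc N then ?T h n m else 0)"
    proof -
      define f where "f h n m = (if ?g h n m = Suc N
        then ?C h n m * (t ^ (?g h n m - 1) * ?e / fact (?g h n m - 1)) else 0)" for h n m
      have f: "f h n m \<ge> 0" for h n m
        unfolding f_def using C[of h n m] assms by (auto intro!: mult_nonneg_nonneg)
      have "ennreal (\<Sum>h\<le>N. \<Sum>n\<le>Suc N. \<Sum>m\<in>multi_idx l n. f h n m) =
          (\<Sum>h\<le>N. \<Sum>n\<le>Suc N. \<Sum>m\<in>multi_idx l n. ennreal (f h n m))"
        using f by (simp add: sum_ennreal sum_nonneg del: sum.atMost_Suc)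
      moreover have "ennreal (f h n m) = (if ?g h n m = Suc N then ?T h n m else 0)" for h n m
        by (simp add: f_def)
      ultimately have "ennreal (\<Sum>h\<le>N. \<Sum>n\<le>Suc N. \<Sum>m\<in>multi_idx l n. f h n m) =
          (\<Sum>h\<le>N. \<Sum>n\<le>Suc N. \<Sum>m\<in>multi_idx l n. if ?g h n m = Suc N then ?T h n m else 0)"
        by simp
      then show ?thesis
        unfolding f_def .
    qed
    also have "\<dots> = (\<Sum>h\<le>N. \<Sum>n. \<Sum>m\<in>multi_idx l n. if ?g h n m = Suc N then ?T h n m else 0)"
    proof (intro sum.cong refl suminf_finite[symmetric] sum.neutral ballI)
      fix h n m assume "n \<notin> {..Suc N}"
      then show "(if ?g h n m = Suc N then ?T h n m else 0) = 0"
        using gamma0_ge[of "Suc h" n k l m] by auto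
    qed simp
    also have "\<dots> = (\<Sum>h. \<Sum>n. \<Sum>m\<in>multi_idx l n. if ?g h n m = Suc N then ?T h n m else 0)"
    proof (rule suminf_finite[symmetric])
      fix h assume "h \<notin> {..N}"
      then have "(if ?g h n m = Suc N then ?T h n m else 0) = 0" for n m
        using gamma0_ge[of "Suc h" n k l m] by auto
      then show "(\<Sum>n. \<Sum>m\<in>multi_idx l n. if ?g h n m = Suc N then ?T h n m else 0) = 0"
        by simp
    qed simp
    finally show ?thesis .
  qed
  have "ennreal (erlang_trans k l mu lam t (0, 0) (0, 0)) = (\<Sum>N. ennreal (?e * (t ^ N / fact N * ?w N)))"
  proof -
    have norm: "summable (\<lambda>N. norm (t ^ N / fact N * ?w N))"
      using assms lam by (intro summable_walk_weight) auto
    have sm: "summable (\<lambda>N. ?e * (t ^ N / fact N * ?w N))"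
      by (rule summable_mult[OF summable_norm_cancel[OF norm]])
    then have "(\<Sum>N. ennreal (?e * (t ^ N / fact N * ?w N))) = ennreal (\<Sum>N. ?e * (t ^ N / fact N * ?w N))"
      using w assms by (intro suminf_ennreal2) auto
    also have "(\<Sum>N. ?e * (t ^ N / fact N * ?w N)) = erlang_trans k l mu lam t (0, 0) (0, 0)"
    proof -
      have "erlang_trans k l mu lam t (0, 0) (0, 0) = ?e * (\<Sum>N. t ^ N / fact N * ?w N)"
        unfolding Lam_def using assms lam by (intro erlang_trans_walk_weight) auto
      then show ?thesis
        using suminf_mult[OF summable_norm_cancel[OF norm], of ?e] by simp
    qed
    finally show ?thesis ..
  qed
  also have "\<dots> = (\<Sum>N. \<Sum>h. \<Sum>n. \<Sum>m\<in>multi_idx l n. if ?g h n m = Suc N then ?T h n m else 0)"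
    by (simp only: expansion)
  also have "\<dots> = (\<Sum>h. \<Sum>N. \<Sum>n. \<Sum>m\<in>multi_idx l n. if ?g h n m = Suc N then ?T h n m else 0)"
    by (rule suminf_swap_ennreal)
  also have "\<dots> = (\<Sum>h. \<Sum>n. \<Sum>N. \<Sum>m\<in>multi_idx l n. if ?g h n m = Suc N then ?T h n m else 0)"
    by (subst suminf_swap_ennreal) simp
  also have "\<dots> = (\<Sum>h. \<Sum>n. \<Sum>m\<in>multi_idx l n. \<Sum>N. if ?g h n m = Suc N then ?T h n m else 0)"
    by (subst suminf_sum) auto
  also have "\<dots> = (\<Sum>h. \<Sum>n. \<Sum>m\<in>multi_idx l n. ?T h n m)"
  proof (intro suminf_cong sum.cong refl)
    fix h n m
    have "?g h n m = Suc (?g h n m - 1)"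
      using gamma0_ge[of "Suc h" n k l m] by simp
    then have "(\<Sum>N. if ?g h n m = Suc N then ?T h n m else 0) =
        (\<Sum>N\<in>{?g h n m - 1}. if ?g h n m = Suc N then ?T h n m else 0)"
      by (intro suminf_finite) auto
    then show "(\<Sum>N. if ?g h n m = Suc N then ?T h n m else 0) = ?T h n m"
      using \<open>?g h n m = Suc (?g h n m - 1)\<close> by simp
  qed
  finally show ?thesis
    by (simp add: Let_def)
qed

section \<open>Laplace transforms of continuous functions\<close>

text \<open>The growth constant K is part of the predicate because its summability is what justifies
  the exchange of the transform with a series.\<close>

definition has_laplace :: "(real \<Rightarrow> real) \<Rightarrow> real \<Rightarrow> real \<Rightarrow> (real \<Rightarrow> real) \<Rightarrow> bool" where
  "has_laplace f a K L \<longleftrightarrow> continuous_on {0..} f \<and> (\<forall>t\<ge>0. \<bar>f t\<bar> \<le> K * exp (a * t)) \<and>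
    (\<forall>s>a. (LINT t:{0..}|lborel. exp (- s * t) * f t) = L s)"

lemma has_laplaceI:
  assumes "continuous_on {0..} f" "\<And>t. t \<ge> 0 \<Longrightarrow> \<bar>f t\<bar> \<le> K * exp (a * t)"
    and "\<And>s. s > a \<Longrightarrow> (LINT t:{0..}|lborel. exp (- s * t) * f t) = L s"
  shows "has_laplace f a K L"
  using assms by (simp add: has_laplace_def)

lemma has_laplaceD:
  assumes "has_laplace f a K L"
  shows "continuous_on {0..} f" "t \<ge> 0 \<Longrightarrow> \<bar>f t\<bar> \<le> K * exp (a * t)"
    and "s > a \<Longrightarrow> (LINT t:{0..}|lborel. exp (- s * t) * f t) = L s"
  using assms by (simp_all add: has_laplace_def)

lemma has_laplace_cong:
  assumes "has_laplace f a K L" "\<And>t. t \<ge> 0 \<Longrightarrow> g t = f t" "\<And>s. s > a \<Longrightarrow> M s = L s"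
  shows "has_laplace g a K M"
proof (rule has_laplaceI)
  show "continuous_on {0..} g"
    using has_laplaceD(1)[OF assms(1)] assms(2) by (subst continuous_on_cong[of _ _ g f]) auto
  show "\<bar>g t\<bar> \<le> K * exp (a * t)" if "t \<ge> 0" for t
    using has_laplaceD(2)[OF assms(1)] assms(2) that by simp
  show "(LINT t:{0..}|lborel. exp (- s * t) * g t) = M s" if "s > a" for s
  proof -
    have "(LINT t:{0..}|lborel. exp (- s * t) * g t) = (LINT t:{0..}|lborel. exp (- s * t) * f t)"
      using assms(2) by (intro set_lebesgue_integral_cong) auto
    then show ?thesis
      using has_laplaceD(3)[OF assms(1) that] assms(3)[OF that] by simp
  qed
qed

lemma has_laplace_bound_nonneg: "has_laplace f a K L \<Longrightarrow> K \<ge> 0"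
  using has_laplaceD(2)[of f a K L 0] by (simp add: order.trans[OF abs_ge_zero])

lemma
  assumes "s > (0::real)"
  shows set_integrable_exp_neg: "set_integrable lborel {0..} (\<lambda>t. exp (- s * t))"
    and set_integral_exp_neg: "(LINT t:{0..}|lborel. exp (- s * t)) = 1 / s"
proof -
  have "(\<integral>\<^sup>+t. ennreal (erlang_density 0 s t) \<partial>lborel) = ennreal 1"
    using nn_integral_erlang_ith_moment[OF assms, of 0 0] by simp
  then have "has_bochner_integral lborel (erlang_density 0 s) 1"
    using assms by (intro has_bochner_integral_nn_integral) auto
  then have "has_bochner_integral lborel (\<lambda>t. 1 / s * erlang_density 0 s t) (1 / s * 1)"
    by (rule has_bochner_integral_mult_right)
  moreover have "1 / s * erlang_density 0 s t = indicator {0..} t *\<^sub>R exp (- s * t)" for t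
    using assms by (auto simp: erlang_density_def split: split_indicator)
  ultimately have "has_bochner_integral lborel (\<lambda>t. indicator {0..} t *\<^sub>R exp (- s * t)) (1 / s)"
    by simp
  then show "set_integrable lborel {0..} (\<lambda>t. exp (- s * t))"
    "(LINT t:{0..}|lborel. exp (- s * t)) = 1 / s"
    unfolding set_integrable_def set_lebesgue_integral_def
    by (auto simp: has_bochner_integral_iff)
qed

lemma has_laplace_integrand_bound:
  assumes "has_laplace f a K L" "t \<ge> 0"
  shows "\<bar>exp (- s * t) * f t\<bar> \<le> K * exp (- (s - a) * t)"
proof -
  have "\<bar>exp (- s * t) * f t\<bar> \<le> exp (- s * t) * (K * exp (a * t))"
    using has_laplaceD(2)[OF assms] by (simp add: abs_mult)
  also have "\<dots> = K * exp (- (s - a) * t)"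
    by (simp add: algebra_simps exp_add[symmetric])
  finally show ?thesis .
qed

lemma set_integrable_laplace:
  assumes "has_laplace f a K L" "s > a"
  shows "set_integrable lborel {0..} (\<lambda>t. exp (- s * t) * f t)"
  unfolding set_integrable_def
proof (rule Bochner_Integration.integrable_bound)
  have "set_integrable lborel {0..} (\<lambda>t. K * exp (- (s - a) * t))"
    using assms(2) by (intro set_integrable_mult_right set_integrable_exp_neg) simp
  then show "integrable lborel (\<lambda>t. indicator {0..} t *\<^sub>R (K * exp (- (s - a) * t)))"
    by (simp add: set_integrable_def)
  show "(\<lambda>t. indicator {0..} t *\<^sub>R (exp (- s * t) * f t)) \<in> borel_measurable lborel"
  proof -
    have "(\<lambda>t. indicator {0..} t *\<^sub>R (exp (- s * t) * f t)) \<in> borel_measurable borel"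
      by (intro borel_measurable_continuous_on_indicator continuous_intros has_laplaceD(1)[OF assms(1)]) auto
    then show ?thesis
      by simp
  qed
  show "AE t in lborel. norm (indicator {0..} t *\<^sub>R (exp (- s * t) * f t))
      \<le> norm (indicator {0..} t *\<^sub>R (K * exp (- (s - a) * t)))"
    using has_laplace_integrand_bound[OF assms(1), of _ s] has_laplace_bound_nonneg[OF assms(1)]
    by (intro AE_I2) (auto simp: abs_mult split: split_indicator)
qed

lemma has_laplace_cmult:
  assumes "has_laplace f a K L"
  shows "has_laplace (\<lambda>t. u * f t) a (\<bar>u\<bar> * K) (\<lambda>s. u * L s)"
proof (rule has_laplaceI)
  show "continuous_on {0..} (\<lambda>t. u * f t)"
    by (intro continuous_intros has_laplaceD(1)[OF assms])
  show "\<bar>u * f t\<bar> \<le> \<bar>u\<bar> * K * exp (a * t)" if "t \<ge> 0" for t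
    using has_laplaceD(2)[OF assms that] by (simp add: abs_mult mult.assoc mult_left_mono)
  show "(LINT t:{0..}|lborel. exp (- s * t) * (u * f t)) = u * L s" if "s > a" for s
  proof -
    have "(\<lambda>t. exp (- s * t) * (u * f t)) = (\<lambda>t. u * (exp (- s * t) * f t))"
      by (simp add: mult_ac)
    then show ?thesis
      using has_laplaceD(3)[OF assms that] by simp
  qed
qed

lemma has_laplace_diff:
  assumes "has_laplace f a K L" "has_laplace g a K' L'"
  shows "has_laplace (\<lambda>t. f t - g t) a (K + K') (\<lambda>s. L s - L' s)"
proof (rule has_laplaceI)
  show "continuous_on {0..} (\<lambda>t. f t - g t)"
    by (intro continuous_intros has_laplaceD(1)[OF assms(1)] has_laplaceD(1)[OF assms(2)])
  show "\<bar>f t - g t\<bar> \<le> (K + K') * exp (a * t)" if "t \<ge> 0" for t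
    using has_laplaceD(2)[OF assms(1) that] has_laplaceD(2)[OF assms(2) that]
    by (simp add: distrib_right)
  show "(LINT t:{0..}|lborel. exp (- s * t) * (f t - g t)) = L s - L' s" if "s > a" for s
    using has_laplaceD(3)[OF assms(1) that] has_laplaceD(3)[OF assms(2) that]
      set_integral_diff(2)[OF set_integrable_laplace[OF assms(1) that] set_integrable_laplace[OF assms(2) that]]
    by (simp add: right_diff_distrib)
qed

lemma has_laplace_shift:
  assumes "has_laplace f a K L"
  shows "has_laplace (\<lambda>t. exp (- b * t) * f t) (a - b) K (\<lambda>s. L (s + b))"
proof (rule has_laplaceI)
  show "continuous_on {0..} (\<lambda>t. exp (- b * t) * f t)"
    by (intro continuous_intros has_laplaceD(1)[OF assms])
  show "\<bar>exp (- b * t) * f t\<bar> \<le> K * exp ((a - b) * t)" if "t \<ge> 0" for t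
    using has_laplace_integrand_bound[OF assms that, of b] by (simp add: algebra_simps)
  show "(LINT t:{0..}|lborel. exp (- s * t) * (exp (- b * t) * f t)) = L (s + b)" if "s > a - b" for s
  proof -
    have "(\<lambda>t. exp (- s * t) * (exp (- b * t) * f t)) = (\<lambda>t. exp (- (s + b) * t) * f t)"
      by (simp add: algebra_simps mult_exp_exp mult.assoc[symmetric])
    then show ?thesis
      using has_laplaceD(3)[OF assms, of "s + b"] that by simp
  qed
qed

lemma has_laplace_mono:
  assumes "has_laplace f a K L" "a \<le> b"
  shows "has_laplace f b K L"
proof (rule has_laplaceI)
  show "\<bar>f t\<bar> \<le> K * exp (b * t)" if "t \<ge> 0" for t
  proof -
    have "K * exp (a * t) \<le> K * exp (b * t)"
      using assms that by (intro mult_left_mono has_laplace_bound_nonneg[OF assms(1)]) (simp add: mult_right_mono)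
    then show ?thesis
      using has_laplaceD(2)[OF assms(1) that] by linarith
  qed
qed (use has_laplaceD[OF assms(1)] assms(2) in auto)

lemma summable_has_laplace:
  assumes "\<And>j. has_laplace (f j) a (K j) (L j)" "summable K" "t \<ge> 0"
  shows "summable (\<lambda>j. \<bar>f j t\<bar>)"
proof (rule summable_comparison_test')
  show "summable (\<lambda>j. K j * exp (a * t))"
    using assms(2) by (rule summable_mult2)
  show "norm \<bar>f j t\<bar> \<le> K j * exp (a * t)" if "j \<ge> 0" for j
    using has_laplaceD(2)[OF assms(1,3)] by simp
qed

text \<open>After multiplication by \<open>exp (- a * t)\<close> the terms are bounded by
  \<open>K j\<close> uniformly in \<open>t\<close>, so the Weierstrass test gives continuity. The
  integrals of the absolute values at \<open>s\<close> are at most \<open>K j / (s - a)\<close>,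
  which justifies integrating termwise.\<close>

lemma has_laplace_suminf:
  assumes f: "\<And>j. has_laplace (f j) a (K j) (L j)" and K: "summable K"
  shows "has_laplace (\<lambda>t. \<Sum>j. f j t) a (\<Sum>j. K j) (\<lambda>s. \<Sum>j. L j s)"
proof (rule has_laplaceI)
  note sm = summable_has_laplace[where f = f, OF f K]
  have bound: "\<bar>exp (- a * t) * f j t\<bar> \<le> K j" if "t \<ge> 0" for j t
    using has_laplace_integrand_bound[OF f that, of a j] by simp
  have "continuous_on {0..} (\<lambda>t. \<Sum>j. exp (- a * t) * f j t)"
  proof (rule uniform_limit_theorem)
    show "uniform_limit {0..} (\<lambda>n t. \<Sum>j<n. exp (- a * t) * f j t) (\<lambda>t. \<Sum>j. exp (- a * t) * f j t) sequentially"
      using bound K by (intro Weierstrass_m_test) auto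
    show "\<forall>\<^sub>F n in sequentially. continuous_on {0..} (\<lambda>t. \<Sum>j<n. exp (- a * t) * f j t)"
      by (intro always_eventually allI continuous_intros has_laplaceD(1)[OF f])
  qed simp
  then have "continuous_on {0..} (\<lambda>t. exp (a * t) * (\<Sum>j. exp (- a * t) * f j t))"
    by (intro continuous_intros)
  moreover have "exp (a * t) * (\<Sum>j. exp (- a * t) * f j t) = (\<Sum>j. f j t)" if "t \<ge> 0" for t
  proof -
    have "(\<Sum>j. exp (- a * t) * f j t) = exp (- a * t) * (\<Sum>j. f j t)"
      using sm[OF that] by (intro suminf_mult) (rule summable_rabs_cancel)
    then show ?thesis
      by (simp add: exp_minus)
  qed
  ultimately show "continuous_on {0..} (\<lambda>t. \<Sum>j. f j t)"
    by (subst (asm) continuous_on_cong[OF refl]) auto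
  show "\<bar>\<Sum>j. f j t\<bar> \<le> (\<Sum>j. K j) * exp (a * t)" if "t \<ge> 0" for t
  proof -
    have "\<bar>\<Sum>j. f j t\<bar> \<le> (\<Sum>j. \<bar>f j t\<bar>)"
      using sm[OF that] by (rule summable_rabs)
    also have "\<dots> \<le> (\<Sum>j. K j * exp (a * t))"
      using sm[OF that] K has_laplaceD(2)[OF f that] by (intro suminf_le summable_mult2)
    also have "\<dots> = (\<Sum>j. K j) * exp (a * t)"
      using K by (rule suminf_mult2[symmetric])
    finally show ?thesis .
  qed
  show "(LINT t:{0..}|lborel. exp (- s * t) * (\<Sum>j. f j t)) = (\<Sum>j. L j s)" if s: "s > a" for s
  proof -
    let ?g = "\<lambda>j t. indicator {0..} t *\<^sub>R (exp (- s * t) * f j t)"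
    have int: "integrable lborel (?g j)" for j
      using set_integrable_laplace[OF f s] by (simp add: set_integrable_def)
    have ae: "summable (\<lambda>j. norm (?g j t))" for t
      using sm[of t] by (auto simp: abs_mult split: split_indicator)
    have le: "(\<integral>t. norm (?g j t) \<partial>lborel) \<le> K j * (1 / (s - a))" for j
    proof -
      have *: "set_integrable lborel {0..} (\<lambda>t. K j * exp (- (s - a) * t))"
        using s by (intro set_integrable_mult_right set_integrable_exp_neg) simp
      have "(\<integral>t. norm (?g j t) \<partial>lborel) \<le> (LINT t:{0..}|lborel. K j * exp (- (s - a) * t))"
        unfolding set_lebesgue_integral_def
        using has_laplace_integrand_bound[OF f, of _ s j] * int
        by (intro integral_mono) (auto simp: set_integrable_def split: split_indicator)
      also have "\<dots> = K j * (1 / (s - a))"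
        using s set_integral_exp_neg[of "s - a"] by simp
      finally show ?thesis .
    qed
    have sum: "summable (\<lambda>j. \<integral>t. norm (?g j t) \<partial>lborel)"
    proof (rule summable_comparison_test')
      show "summable (\<lambda>j. K j * (1 / (s - a)))"
        using K by (rule summable_mult2)
    qed (use le in auto)
    have "(\<lambda>j. integral\<^sup>L lborel (?g j)) sums (\<integral>t. (\<Sum>j. ?g j t) \<partial>lborel)"
      by (rule sums_integral[OF int _ sum]) (use ae in auto)
    moreover have "integral\<^sup>L lborel (?g j) = L j s" for j
      using has_laplaceD(3)[OF f s] by (simp add: set_lebesgue_integral_def)
    moreover have "(\<Sum>j. ?g j t) = indicator {0..} t *\<^sub>R (exp (- s * t) * (\<Sum>j. f j t))" for t
      using sm[of t, THEN summable_rabs_cancel] by (auto simp: suminf_mult split: split_indicator)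
    ultimately show ?thesis
      by (simp add: sums_iff set_lebesgue_integral_def)
  qed
qed

text \<open>In the variable u = exp (- t), a vanishing transform says that all moments vanish, so that the
  Weierstrass approximation theorem applies.\<close>

lemma has_laplace_zero:
  assumes f: "has_laplace f a K (\<lambda>_. 0)" and t0: "t0 \<ge> 0"
  shows "f t0 = 0"
proof -
  note cont = has_laplaceD(1)[OF f]
  \<comment> \<open>The exponent \<open>a + 1\<close> has one unit more than the growth of
    \<open>f\<close> requires. It makes \<open>W\<close> bounded by \<open>K * u\<close>, so that
    the value 0 extends it continuously to \<open>u = 0\<close>.\<close>
  define W where "W u = (if u \<le> 0 then 0 else u powr (a + 1) * f (- ln u))" for u
  have W_exp: "W (exp (- t)) = exp (- (a + 1) * t) * f t" for t
    by (simp add: W_def powr_def algebra_simps)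
  have W_bound: "\<bar>W u\<bar> \<le> K * u" if "u \<in> {0..1}" for u
  proof (cases "u = 0")
    case False
    then have u: "u = exp (- (- ln u))" "- ln u \<ge> 0"
      using that by auto
    show ?thesis
      using has_laplace_integrand_bound[OF f u(2), of "a + 1"] W_exp[of "- ln u"] u(1) by simp
  qed (simp add: W_def)
  have W_cont: "continuous_on {0..1} W"
    unfolding continuous_on_eq_continuous_within
  proof
    fix x :: real assume x: "x \<in> {0..1}"
    show "continuous (at x within {0..1}) W"
    proof (cases "x = 0")
      case True
      have "((\<lambda>u. K * u) \<longlongrightarrow> 0) (at 0 within {0..1})"
        by (auto intro!: tendsto_eq_intros)
      then have "(W \<longlongrightarrow> 0) (at 0 within {0..1})"
        by (rule Lim_null_comparison[rotated]) (auto simp: eventually_at_filter W_bound)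
      then show ?thesis
        by (simp add: True continuous_within W_def)
    next
      case False
      have "continuous_on {0<..1} (\<lambda>u. u powr (a + 1) * f (- ln u))"
        by (intro continuous_intros continuous_on_compose2[OF cont]) auto
      then have "continuous_on {0<..1} W"
        by (subst continuous_on_cong[OF refl, of _ _ "\<lambda>u. u powr (a + 1) * f (- ln u)"]) (auto simp: W_def)
      moreover have "x \<in> {0<..1}"
        using x False by auto
      ultimately have "continuous (at x within {0<..1}) W"
        by (simp add: continuous_on_eq_continuous_within)
      moreover have "at x within {0..1} = at x within {0<..1}"
        by (rule at_within_nhd[of _ "{0<..}"]) (use x False in auto)
      ultimately show ?thesis
        by simp
    qed
  qed
  let ?F = "\<lambda>t. W (exp (- t))"
  have F_cont: "continuous_on {0..} ?F"
    by (intro continuous_on_compose2[OF W_cont] continuous_intros) auto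
  have F_bound: "\<bar>?F t\<bar> \<le> K" if "t \<ge> 0" for t
  proof -
    have "\<bar>?F t\<bar> \<le> K * exp (- t)"
      using that by (intro W_bound) auto
    also have "\<dots> \<le> K * 1"
      using that has_laplace_bound_nonneg[OF f] by (intro mult_left_mono) auto
    finally show ?thesis
      by simp
  qed
  have int: "set_integrable lborel {0..} (\<lambda>t. exp (- t) * h t)"
    if "continuous_on {0..} h" "\<And>t. t \<ge> 0 \<Longrightarrow> \<bar>h t\<bar> \<le> B" for h and B :: real
  proof -
    have "has_laplace h 0 B (\<lambda>s. LINT t:{0..}|lborel. exp (- s * t) * h t)"
      using that by (intro has_laplaceI) auto
    from set_integrable_laplace[OF this, of 1] show ?thesis
      by simp
  qed
  have FF: "set_integrable lborel {0..} (\<lambda>t. exp (- t) * (?F t * ?F t))"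
  proof (intro int[where B = "K * K"] continuous_intros F_cont)
    fix t :: real assume t: "t \<ge> 0"
    show "\<bar>?F t * ?F t\<bar> \<le> K * K"
      unfolding abs_mult using F_bound[OF t] by (intro mult_mono') auto
  qed
  \<comment> \<open>In the variable u this is the integral of the square of \<open>W\<close> over
    the unit interval. Replacing one factor by a polynomial \<open>e\<close>-close to
    \<open>W\<close> gives 0, so the integral itself is at most \<open>e * K\<close>.\<close>
  let ?I = "LINT t:{0..}|lborel. exp (- t) * (?F t * ?F t)"
  have "?I \<le> e * K" if e: "e > 0" for e
  proof -
    obtain p where p: "real_polynomial_function p" "\<And>u. u \<in> {0..1} \<Longrightarrow> \<bar>W u - p u\<bar> < e"
      using Stone_Weierstrass_real_polynomial_function[OF _ W_cont e] by auto
    then obtain c n where p_eq: "p = (\<lambda>u. \<Sum>i\<le>n. c i * u ^ i)"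
      by (auto simp: real_polynomial_function_iff_sum)
    have p_cont: "continuous_on {0..} (\<lambda>t. p (exp (- t)))"
      unfolding p_eq by (intro continuous_intros)
    have p_bound: "\<bar>p (exp (- t))\<bar> \<le> K + e" if "t \<ge> 0" for t
      using p(2)[of "exp (- t)"] F_bound[OF that] that by auto
    have Fp: "set_integrable lborel {0..} (\<lambda>t. exp (- t) * (?F t * p (exp (- t))))"
      using F_bound p_bound
      by (intro int[where B = "K * (K + e)"] continuous_intros F_cont p_cont) (auto simp: abs_mult intro!: mult_mono')
    have "(LINT t:{0..}|lborel. exp (- t) * (?F t * p (exp (- t)))) = 0"
    proof -
      \<comment> \<open>The i-th moment is a value of the transform: 1 comes from the measure,
        \<open>a + 1\<close> from \<open>W\<close> and \<open>i\<close> from the monomial, and the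
        sum exceeds \<open>a\<close>.\<close>
      have "exp (- t) * (?F t * p (exp (- t))) = (\<Sum>i\<le>n. c i * (exp (- (a + 2 + real i) * t) * f t))" for t
      proof -
        have "exp (- t) * (?F t * (c i * exp (- t) ^ i)) = c i * (exp (- (a + 2 + real i) * t) * f t)" for i
        proof -
          have "exp (- t) * exp (- (a + 1) * t) * exp (- t) ^ i = exp (- (a + 2 + real i) * t)"
            by (simp only: exp_of_nat_mult[symmetric] mult_exp_exp) (simp add: algebra_simps)
          moreover have "A * (B * F * (C * E)) = C * (A * B * E * F)" for A B C E F :: real
            by (simp add: mult_ac)
          ultimately show ?thesis
            unfolding W_exp by (simp only:)
        qed
        then show ?thesis
          by (simp only: p_eq sum_distrib_left)
      qed
      then have "(LINT t:{0..}|lborel. exp (- t) * (?F t * p (exp (- t)))) =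
          (\<integral>t. (\<Sum>i\<le>n. indicator {0..} t *\<^sub>R (c i * (exp (- (a + 2 + real i) * t) * f t))) \<partial>lborel)"
        by (simp only: set_lebesgue_integral_def scaleR_sum_right)
      also have "\<dots> = (\<Sum>i\<le>n. LINT t:{0..}|lborel. c i * (exp (- (a + 2 + real i) * t) * f t))"
        unfolding set_lebesgue_integral_def
      proof (rule Bochner_Integration.integral_sum)
        fix i
        have "set_integrable lborel {0..} (\<lambda>t. c i * (exp (- (a + 2 + real i) * t) * f t))"
          by (intro set_integrable_mult_right set_integrable_laplace[OF f]) simp
        then show "integrable lborel (\<lambda>t. indicator {0..} t *\<^sub>R (c i * (exp (- (a + 2 + real i) * t) * f t)))"
          by (simp only: set_integrable_def)
      qed
      also have "\<dots> = 0"
      proof (intro sum.neutral ballI)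
        fix i
        show "(LINT t:{0..}|lborel. c i * (exp (- (a + 2 + real i) * t) * f t)) = 0"
          using has_laplaceD(3)[OF f, of "a + 2 + real i"] by (simp only: set_integral_mult_right)
      qed
      finally show ?thesis .
    qed
    then have "?I = (LINT t:{0..}|lborel. exp (- t) * (?F t * ?F t) - exp (- t) * (?F t * p (exp (- t))))"
      using set_integral_diff(2)[OF FF Fp] by simp
    also have "\<dots> \<le> (LINT t:{0..}|lborel. (e * K) * exp (- 1 * t))"
    proof (rule set_integral_mono)
      show "set_integrable lborel {0..} (\<lambda>t. exp (- t) * (?F t * ?F t) - exp (- t) * (?F t * p (exp (- t))))"
        by (rule set_integral_diff(1)[OF FF Fp])
      show "set_integrable lborel {0..} (\<lambda>t. (e * K) * exp (- 1 * t))"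
        by (intro set_integrable_mult_right set_integrable_exp_neg) simp
      fix t :: real assume "t \<in> {0..}"
      then have t: "t \<ge> 0"
        by simp
      have "?F t * (?F t - p (exp (- t))) \<le> \<bar>?F t\<bar> * \<bar>?F t - p (exp (- t))\<bar>"
        by (metis abs_ge_self abs_mult)
      also have "\<dots> \<le> K * e"
        using F_bound[OF t] p(2)[of "exp (- t)"] t has_laplace_bound_nonneg[OF f] by (intro mult_mono) auto
      finally have "exp (- t) * (?F t * (?F t - p (exp (- t)))) \<le> exp (- t) * (K * e)"
        by (intro mult_left_mono) auto
      then show "exp (- t) * (?F t * ?F t) - exp (- t) * (?F t * p (exp (- t))) \<le> (e * K) * exp (- 1 * t)"
        by (simp add: algebra_simps)
    qed
    also have "\<dots> = e * K"
      using set_integral_exp_neg[of 1] by simp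
    finally show ?thesis .
  qed
  then have "?I \<le> e" if "e > 0" for e
  proof -
    \<comment> \<open>The summand 1 keeps the denominator positive when \<open>K\<close> is
      0.\<close>
    have "?I \<le> (e / (K + 1)) * K"
      using that has_laplace_bound_nonneg[OF f] \<open>\<And>e. e > 0 \<Longrightarrow> ?I \<le> e * K\<close>[of "e / (K + 1)"] by simp
    also have "\<dots> \<le> e"
      using that has_laplace_bound_nonneg[OF f] by (simp add: field_simps)
    finally show ?thesis .
  qed
  then have I0: "?I \<le> 0"
    by (rule field_le_epsilon[of _ 0, simplified])
  \<comment> \<open>A continuous nonnegative function with integral 0 over an interval vanishes on
    it. The interval lies to the right of \<open>t0\<close>, since \<open>t0\<close> may be
    0.\<close>
  let ?h = "\<lambda>t. exp (- t) * (?F t * ?F t)"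
  have h_cont: "continuous_on {t0..t0 + 1} ?h"
    using t0 by (intro continuous_intros continuous_on_subset[OF F_cont]) auto
  have sub: "set_integrable lborel {t0..t0 + 1} ?h"
    using t0 by (intro set_integrable_subset[OF FF]) auto
  have "(LINT t:{t0..t0 + 1}|lborel. ?h t) \<le> ?I"
    unfolding set_lebesgue_integral_def using FF sub t0
    by (intro integral_mono) (auto simp: set_integrable_def split: split_indicator)
  moreover have "(LINT t:{t0..t0 + 1}|lborel. ?h t) \<ge> 0"
    unfolding set_lebesgue_integral_def by (intro Bochner_Integration.integral_nonneg) (auto split: split_indicator)
  ultimately have "(LINT t:{t0..t0 + 1}|lborel. ?h t) = 0"
    using I0 by linarith
  then have "(?h has_integral 0) (cbox t0 (t0 + 1))"
    using set_borel_integral_eq_integral[OF sub] by (simp add: has_integral_integral)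
  then have "?h t0 = 0"
    using h_cont by (intro has_integral_0_cbox_imp_0[of t0 "t0 + 1" ?h]) auto
  then show ?thesis
    by (simp add: W_exp)
qed

lemma has_laplace_unique:
  assumes "has_laplace f a K L" "has_laplace g b K' L'" "t \<ge> 0"
    and "\<And>s. s > max a b \<Longrightarrow> L s = L' s"
  shows "f t = g t"
proof -
  have "has_laplace (\<lambda>t. f t - g t) (max a b) (K + K') (\<lambda>s. L s - L' s)"
    using assms by (intro has_laplace_diff) (auto intro: has_laplace_mono)
  then have "has_laplace (\<lambda>t. f t - g t) (max a b) (K + K') (\<lambda>_. 0)"
    by (rule has_laplace_cong) (use assms in auto)
  from has_laplace_zero[OF this assms(3)] show ?thesis
    by simp
qed

section \<open>Mittag-Leffler series\<close>

lemma pw_nonneg: "pw t a \<ge> 0"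
  by (simp add: pw_def)

lemma pw_mono: "a \<ge> 0 \<Longrightarrow> 0 \<le> s \<Longrightarrow> s \<le> t \<Longrightarrow> pw s a \<le> pw t a"
  by (auto simp: pw_def intro: powr_mono2)

lemma pw_add: "a \<ge> 0 \<Longrightarrow> b \<ge> 0 \<Longrightarrow> pw t (a + b) = pw t a * pw t b"
  by (auto simp: pw_def powr_add)

lemma pw_powr_power: "a > 0 \<Longrightarrow> (t powr a) ^ n = pw t (a * real n)"
  by (cases "t = 0 \<or> n = 0") (auto simp: pw_def powr_power mult.commute)

lemma continuous_on_pw: "a \<ge> 0 \<Longrightarrow> continuous_on {0..} (\<lambda>t. pw t a)"
  by (cases "a = 0") (auto simp: pw_def intro!: continuous_on_powr' continuous_on_id continuous_on_const)

text \<open>This is the Gamma integral under the substitution by \<open>s * t\<close>. For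
  \<open>b = 1\<close> the function \<open>pw\<close> differs from \<open>powr\<close> at the point
  0, which is why the integrands are compared almost everywhere.\<close>

lemma nn_integral_laplace_pw:
  assumes "b > 0" "s > 0"
  shows "(\<integral>\<^sup>+t. ennreal (indicator {0..} t *\<^sub>R (exp (- s * t) * pw t (b - 1))) \<partial>lborel) =
    ennreal (Gamma b * s powr (- b))"
proof -
  let ?I = "\<integral>\<^sup>+t. ennreal (indicator {0..} t *\<^sub>R (exp (- s * t) * pw t (b - 1))) \<partial>lborel"
  have "ennreal (Gamma b) =
      (\<integral>\<^sup>+t. ennreal (indicator {0..} t * t powr (b - 1) / exp t) \<partial>lborel)"
    by (rule Gamma_conv_nn_integral_real[OF assms(1)])
  also have "\<dots> = ennreal \<bar>s\<bar> *
      (\<integral>\<^sup>+t. ennreal (indicator {0..} (0 + s * t) * (0 + s * t) powr (b - 1) / exp (0 + s * t)) \<partial>lborel)"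
    using assms by (intro nn_integral_real_affine) auto
  also have "(\<integral>\<^sup>+t. ennreal (indicator {0..} (0 + s * t) * (0 + s * t) powr (b - 1) / exp (0 + s * t)) \<partial>lborel)
      = (\<integral>\<^sup>+t. ennreal (s powr (b - 1)) *
        ennreal (indicator {0..} t *\<^sub>R (exp (- s * t) * pw t (b - 1))) \<partial>lborel)"
  proof (rule nn_integral_cong_AE)
    show "AE t in lborel. ennreal (indicator {0..} (0 + s * t) * (0 + s * t) powr (b - 1) / exp (0 + s * t)) =
        ennreal (s powr (b - 1)) * ennreal (indicator {0..} t *\<^sub>R (exp (- s * t) * pw t (b - 1)))"
      using AE_lborel_singleton[of 0]
    proof eventually_elim
      case (elim t)
      have "indicator {0..} (s * t) = (indicator {0..} t :: real)"
        using assms by (auto simp: zero_le_mult_iff split: split_indicator)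
      then show ?case
        using elim assms
        by (cases "t \<ge> 0") (auto simp: ennreal_mult[symmetric] powr_mult pw_def exp_minus field_simps)
    qed
  qed
  also have "\<dots> = ennreal (s powr (b - 1)) * ?I"
    by (intro nn_integral_cmult measurable_compose[OF _ measurable_ennreal])
      (auto simp: pw_def)
  finally have "ennreal (Gamma b) = ennreal (s powr b) * ?I"
    using assms by (simp add: mult.assoc[symmetric] ennreal_mult[symmetric] powr_diff)
  then have "ennreal (s powr (- b)) * ennreal (Gamma b) = (ennreal (s powr (- b)) * ennreal (s powr b)) * ?I"
    by (simp add: mult.assoc)
  also have "ennreal (s powr (- b)) * ennreal (s powr b) = 1"
    using assms by (simp add: ennreal_mult[symmetric] powr_add[symmetric])
  finally show ?thesis
    using assms by (simp add: ennreal_mult[symmetric] mult.commute)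
qed

lemma
  assumes "b > 0" "s > 0"
  shows set_integrable_laplace_pw: "set_integrable lborel {0..} (\<lambda>t. exp (- s * t) * pw t (b - 1))"
    and set_integral_laplace_pw:
      "(LINT t:{0..}|lborel. exp (- s * t) * pw t (b - 1)) = Gamma b * s powr (- b)"
proof -
  have "has_bochner_integral lborel (\<lambda>t. indicator {0..} t *\<^sub>R (exp (- s * t) * pw t (b - 1)))
      (Gamma b * s powr (- b))"
    using nn_integral_laplace_pw[OF assms] assms
    by (intro has_bochner_integral_nn_integral) (auto simp: pw_def)
  then show "set_integrable lborel {0..} (\<lambda>t. exp (- s * t) * pw t (b - 1))"
    "(LINT t:{0..}|lborel. exp (- s * t) * pw t (b - 1)) = Gamma b * s powr (- b)"
    unfolding set_integrable_def set_lebesgue_integral_def by (auto simp: has_bochner_integral_iff)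
qed

text \<open>The growth bound compares the transform with its integral over {t..t + 1}.\<close>

lemma has_laplace_pw:
  assumes "b \<ge> 1" "a > 0"
  shows "has_laplace (\<lambda>t. pw t (b - 1) / Gamma b) a (exp a * a powr (- b)) (\<lambda>s. s powr (- b))"
proof (rule has_laplaceI)
  have G: "Gamma b > 0"
    using assms by (intro Gamma_real_pos) simp
  show "continuous_on {0..} (\<lambda>t. pw t (b - 1) / Gamma b)"
    unfolding divide_inverse using assms by (intro continuous_on_mult_right continuous_on_pw) auto
  \<comment> \<open>Dividing by \<open>Gamma b\<close> leaves a constant that is geometric in
    \<open>b\<close>. This is what makes the constants summable over the indices j and q.\<close>
  show "\<bar>pw t (b - 1) / Gamma b\<bar> \<le> exp a * a powr (- b) * exp (a * t)" if t: "t \<ge> 0" for t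
  proof -
    \<comment> \<open>On the unit interval to the right of \<open>t\<close> the exponential is
      smallest at the right end and the power at the left end. The shift by 1 is the origin of the
      factor \<open>exp a\<close>.\<close>
    let ?m = "exp (- a * (t + 1)) * pw t (b - 1)"
    have "?m = (\<integral>x. indicator {t..t + 1} x *\<^sub>R ?m \<partial>lborel)"
      by simp
    also have "\<dots> \<le> (\<integral>x. indicator {0..} x *\<^sub>R (exp (- a * x) * pw x (b - 1)) \<partial>lborel)"
    proof (rule integral_mono)
      show "integrable lborel (\<lambda>x. indicator {0..} x *\<^sub>R (exp (- a * x) * pw x (b - 1)))"
        using set_integrable_laplace_pw[of b a] assms by (simp add: set_integrable_def)
      show "indicator {t..t + 1} x *\<^sub>R ?m \<le> indicator {0..} x *\<^sub>R (exp (- a * x) * pw x (b - 1))" for x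
      proof (cases "x \<in> {t..t + 1}")
        case True
        then have "?m \<le> exp (- a * x) * pw x (b - 1)"
          using assms t pw_nonneg by (intro mult_mono pw_mono) auto
        then show ?thesis
          using True t by simp
      qed (auto simp: pw_nonneg split: split_indicator)
    qed simp
    also have "\<dots> = Gamma b * a powr (- b)"
      using set_integral_laplace_pw[of b a] assms by (simp add: set_lebesgue_integral_def)
    finally have le: "exp (a * (t + 1)) * ?m \<le> exp (a * (t + 1)) * (Gamma b * a powr (- b))"
      by (intro mult_left_mono) auto
    have m: "exp (a * (t + 1)) * ?m = pw t (b - 1)"
      by (simp add: mult.assoc[symmetric] mult_exp_exp)
    have e: "exp (a * (t + 1)) = exp a * exp (a * t)"
      by (simp add: algebra_simps mult_exp_exp)
    have "pw t (b - 1) \<le> exp (a * (t + 1)) * (Gamma b * a powr (- b))"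
      using le by (simp only: m)
    then have "pw t (b - 1) \<le> exp a * a powr (- b) * exp (a * t) * Gamma b"
      by (simp only: e mult_ac)
    then show ?thesis
      using G pw_nonneg[of t "b - 1"] by (simp add: pos_divide_le_eq)
  qed
  show "(LINT t:{0..}|lborel. exp (- s * t) * (pw t (b - 1) / Gamma b)) = s powr (- b)" if "s > a" for s
  proof -
    have "(LINT t:{0..}|lborel. exp (- s * t) * (pw t (b - 1) / Gamma b)) =
        (LINT t:{0..}|lborel. exp (- s * t) * pw t (b - 1)) / Gamma b"
      by simp
    also have "\<dots> = s powr (- b)"
      using set_integral_laplace_pw[of b s] that assms less_imp_neq[OF G] by simp
    finally show ?thesis .
  qed
qed

section \<open>Summing the transforms over j and q\<close>

lemma pochhammer_sums:
  fixes g z :: real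
  assumes "\<bar>z\<bar> < 1"
  shows "(\<lambda>j. pochhammer g j / fact j * z ^ j) sums (1 - z) powr (- g)"
proof -
  have "((- g) gchoose j) * (- z) ^ j = pochhammer g j / fact j * z ^ j" for j
  proof -
    have "(- z) ^ j = (- 1) ^ j * z ^ j"
      by (rule power_minus)
    moreover have "(- 1) ^ j * (- 1) ^ j = (1 :: real)"
      by (simp add: power_mult_distrib[symmetric])
    ultimately show ?thesis
      by (simp add: gbinomial_pochhammer)
  qed
  then show ?thesis
    using gen_binomial_real[of "- z" "- g"] assms by simp
qed

text \<open>The j-th term is a multiple of
  \<open>pw t (alpha * j + b - 1) / Gamma (alpha * j + b)\<close>. The condition on
  \<open>bet\<close> is the convergence of the binomial series at the abscissa \<open>a\<close>, and
  the growth constant is its value there for \<open>\<bar>bet\<bar>\<close>.\<close>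

lemma has_laplace_mittag_leffler3:
  assumes "b \<ge> 1" "alpha > 0" "g > 0" "a > 0" "\<bar>bet\<bar> < a powr alpha"
  shows "has_laplace (\<lambda>t. pw t (b - 1) * mittag_leffler3 alpha b g (bet * t powr alpha)) a
    (exp a * (1 - \<bar>bet\<bar> * a powr (- alpha)) powr (- g) * a powr (- b))
    (\<lambda>s. (1 - bet * s powr (- alpha)) powr (- g) * s powr (- b))"
proof -
  define u where "u j = pochhammer g j / fact j * bet ^ j" for j
  define v where "v j t = pw t (alpha * real j + b - 1) / Gamma (alpha * real j + b)" for j t
  have abs_u: "\<bar>u j\<bar> = pochhammer g j / fact j * \<bar>bet\<bar> ^ j" for j
    using pochhammer_nonneg[of g j] assms by (simp add: u_def abs_mult power_abs)
  have powr_split: "s powr (- (alpha * real j + b)) = (s powr (- alpha)) ^ j * s powr (- b)" if "s > 0" for s j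
    using that by (simp add: powr_power powr_add[symmetric] algebra_simps)
  have lap: "has_laplace (\<lambda>t. u j * v j t) a (\<bar>u j\<bar> * (exp a * a powr (- (alpha * real j + b))))
      (\<lambda>s. u j * s powr (- (alpha * real j + b)))" for j
    unfolding v_def using assms
    by (intro has_laplace_cmult has_laplace_pw) (auto intro: add_increasing)
  \<comment> \<open>Used twice: with \<open>x = \<bar>bet\<bar>\<close> and \<open>w = exp a\<close>
    for the growth constants, and with \<open>x = bet\<close> and \<open>w = 1\<close> for the
    transform.\<close>
  have sums: "(\<lambda>j. w * (pochhammer g j / fact j * (x * s powr (- alpha)) ^ j * s powr (- b))) sums
      (w * ((1 - x * s powr (- alpha)) powr (- g) * s powr (- b)))"
    if "s \<ge> a" "\<bar>x\<bar> = \<bar>bet\<bar>" for s x w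
  proof -
    have "\<bar>bet\<bar> < s powr alpha"
      using assms that powr_mono2[of alpha a s] by linarith
    then have "\<bar>x * s powr (- alpha)\<bar> < 1"
      using that assms by (simp add: abs_mult powr_minus field_simps)
    then show ?thesis
      by (intro sums_mult sums_mult2 pochhammer_sums)
  qed
  have K: "(\<lambda>j. \<bar>u j\<bar> * (exp a * a powr (- (alpha * real j + b)))) sums
      (exp a * (1 - \<bar>bet\<bar> * a powr (- alpha)) powr (- g) * a powr (- b))"
    using sums[of a "\<bar>bet\<bar>" "exp a"] unfolding abs_u powr_split[OF assms(4)]
    by (simp add: power_mult_distrib mult_ac)
  have "has_laplace (\<lambda>t. \<Sum>j. u j * v j t) a
      (\<Sum>j. \<bar>u j\<bar> * (exp a * a powr (- (alpha * real j + b))))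
      (\<lambda>s. \<Sum>j. u j * s powr (- (alpha * real j + b)))"
    by (rule has_laplace_suminf[OF lap sums_summable[OF K]])
  then show ?thesis
    unfolding sums_unique[OF K, symmetric]
  proof (rule has_laplace_cong)
    fix s assume s: "s > a"
    then have "s > 0"
      using assms by simp
    show "(1 - bet * s powr (- alpha)) powr (- g) * s powr (- b) =
        (\<Sum>j. u j * s powr (- (alpha * real j + b)))"
      using sums[of s bet 1] s unfolding powr_split[OF \<open>s > 0\<close>]
      by (intro sums_unique) (simp add: u_def power_mult_distrib mult_ac)
  next
    fix t :: real assume t: "t \<ge> 0"
    let ?x = "\<lambda>j. Gamma (real j + g) * (bet * t powr alpha) ^ j / (fact j * Gamma (alpha * real j + b))"
    have eq: "pw t (b - 1) * (1 / Gamma g * ?x j) = u j * v j t" for j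
    proof -
      have "pw t (alpha * real j + b - 1) = pw t (b - 1) * (t powr alpha) ^ j"
        using pw_add[of "b - 1" "alpha * real j" t] assms
        by (simp add: pw_powr_power algebra_simps)
      moreover have "pochhammer g j = Gamma (real j + g) / Gamma g"
      proof -
        have "g \<notin> \<int>\<^sub>\<le>\<^sub>0"
          using assms by (auto simp: nonpos_Ints_def)
        then show ?thesis
          using pochhammer_Gamma[of g j] by (simp add: add.commute)
      qed
      ultimately show ?thesis
        by (simp add: u_def v_def power_mult_distrib mult_ac)
    qed
    have sm: "summable (\<lambda>j. u j * v j t)"
      by (rule summable_rabs_cancel[OF summable_has_laplace[OF lap sums_summable[OF K] t]])
    show "pw t (b - 1) * mittag_leffler3 alpha b g (bet * t powr alpha) = (\<Sum>j. u j * v j t)"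
    proof (cases "pw t (b - 1) = 0")
      \<comment> \<open>The summability of the Mittag-Leffler series cannot be read off from a
        product with 0, but both sides are then 0.\<close>
      case True
      then show ?thesis
        by (simp add: eq[symmetric])
    next
      case False
      then have ne: "pw t (b - 1) * (1 / Gamma g) \<noteq> 0"
        using Gamma_real_pos[OF assms(3)] by simp
      have "summable (\<lambda>j. (pw t (b - 1) * (1 / Gamma g)) * ?x j)"
        using sm by (simp only: eq[symmetric] mult.assoc)
      from this ne have "summable ?x"
        by (rule summable_mult_D)
      then show ?thesis
        unfolding mittag_leffler3_def eq[symmetric]
        by (simp only: suminf_mult[symmetric] summable_mult mult.assoc[symmetric])
    qed
  qed
qed

definition tempered_term :: "real \<Rightarrow> real \<Rightarrow> real \<Rightarrow> real \<Rightarrow> real \<Rightarrow> real \<Rightarrow> nat \<Rightarrow> real" where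
  "tempered_term theta alpha bet b g t q = exp (- theta * t) * theta ^ q * pw t (b + real q - 1) *
    (mittag_leffler3 alpha (b + real q) g (bet * t powr alpha) -
      (theta * t) powr alpha * mittag_leffler3 alpha (b + alpha + real q) g (bet * t powr alpha))"

text \<open>The factor \<open>exp (- theta * t)\<close> is put aside until the end; adding it moves
  the abscissa from \<open>a\<close> to \<open>a - theta\<close>. The condition
  \<open>a > theta\<close> is the convergence of the geometric series at \<open>a\<close>. For
  uniqueness the existence of a growth constant suffices.\<close>

lemma
  assumes "b \<ge> 1" "0 < alpha" "g > 0" "theta > 0" "a > theta" "\<bar>bet\<bar> < a powr alpha"
  shows summable_tempered_term: "t \<ge> 0 \<Longrightarrow> summable (tempered_term theta alpha bet b g t)"
    and has_laplace_tempered_term: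
      "\<exists>K. has_laplace (\<lambda>t. \<Sum>q. tempered_term theta alpha bet b g t q) (a - theta) K (\<lambda>s.
    (1 - bet * (s + theta) powr (- alpha)) powr (- g) * (s + theta) powr (- b) *
    (1 - theta powr alpha * (s + theta) powr (- alpha)) / (1 - theta / (s + theta)))"
proof -
  have a: "a > 0"
    using assms by simp
  let ?m = "\<lambda>s x. (1 - x * s powr (- alpha)) powr (- g)"
  let ?E = "\<lambda>b t. pw t (b - 1) * mittag_leffler3 alpha b g (bet * t powr alpha)"
  have lap: "has_laplace (\<lambda>t. theta ^ q * (?E (b + real q) t - theta powr alpha * ?E (b + real q + alpha) t)) a
      (\<bar>theta ^ q\<bar> * (exp a * ?m a \<bar>bet\<bar> * a powr (- (b + real q)) +
        \<bar>theta powr alpha\<bar> * (exp a * ?m a \<bar>bet\<bar> * a powr (- (b + real q + alpha)))))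
      (\<lambda>s. theta ^ q * (?m s bet * s powr (- (b + real q)) -
        theta powr alpha * (?m s bet * s powr (- (b + real q + alpha)))))" for q
    using assms a by (intro has_laplace_cmult has_laplace_diff has_laplace_mittag_leffler3) auto
  \<comment> \<open>The growth constants need \<open>y = theta powr alpha\<close>, the transform its
    negative.\<close>
  have sums: "(\<lambda>q. theta ^ q * (x * s powr (- (b + real q)) +
      y * (x * s powr (- (b + real q + alpha))))) sums
      (x * s powr (- b) * (1 + y * s powr (- alpha)) * (1 / (1 - theta / s)))"
    if "s \<ge> a" for s x y
  proof -
    have s: "s > 0"
      using that a by simp
    have "theta ^ q * (x * s powr (- (b + real q)) + y * (x * s powr (- (b + real q + alpha)))) =
        x * s powr (- b) * (1 + y * s powr (- alpha)) * (theta / s) ^ q" for q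
    proof -
      have "s powr (- (b + real q)) = s powr (- b) / s ^ q"
        using s by (simp add: powr_diff powr_add powr_minus powr_realpow field_simps)
      moreover have "s powr (- (b + real q + alpha)) = s powr (- b) / s ^ q * s powr (- alpha)"
        using s by (simp add: powr_diff powr_add powr_realpow powr_minus field_simps)
      ultimately show ?thesis
        by (simp add: power_divide algebra_simps)
    qed
    moreover have "norm (theta / s) < 1"
      using that assms s by simp
    ultimately show ?thesis
      using sums_mult[OF geometric_sums[of "theta / s"]] by simp
  qed
  have K: "summable (\<lambda>q. \<bar>theta ^ q\<bar> * (exp a * ?m a \<bar>bet\<bar> * a powr (- (b + real q)) +
        \<bar>theta powr alpha\<bar> * (exp a * ?m a \<bar>bet\<bar> * a powr (- (b + real q + alpha)))))"
    using sums_summable[OF sums[of a "exp a * ?m a \<bar>bet\<bar>" "theta powr alpha"]] assms by simp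
  \<comment> \<open>The power of \<open>t\<close> in \<open>(theta * t) powr alpha\<close> raises
    the exponent to the one that belongs to the parameter \<open>b + alpha + q\<close> of the second
    Mittag-Leffler function.\<close>
  have eq: "tempered_term theta alpha bet b g t q =
      exp (- theta * t) * (theta ^ q * (?E (b + real q) t - theta powr alpha * ?E (b + real q + alpha) t))"
    if t: "t \<ge> 0" for t q
  proof -
    have "pw t (b + real q + alpha - 1) = pw t (b + real q - 1) * pw t alpha"
      using pw_add[of "b + real q - 1" alpha t] assms by (simp add: algebra_simps)
    moreover have "pw t alpha = t powr alpha"
      using assms by (simp add: pw_def)
    moreover have "(theta * t) powr alpha = theta powr alpha * t powr alpha"
      using assms t by (simp add: powr_mult)
    ultimately show ?thesis
      by (simp add: tempered_term_def algebra_simps)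
  qed
  show "t \<ge> 0 \<Longrightarrow> summable (tempered_term theta alpha bet b g t)"
    using summable_mult[OF summable_rabs_cancel[OF summable_has_laplace[OF lap K, of t]], of "exp (- theta * t)"]
    by (simp only: eq[symmetric])
  let ?S = "\<lambda>t. \<Sum>q. theta ^ q * (?E (b + real q) t - theta powr alpha * ?E (b + real q + alpha) t)"
  have "\<exists>K. has_laplace (\<lambda>t. exp (- theta * t) * ?S t) (a - theta) K (\<lambda>s.
      \<Sum>q. theta ^ q * (?m (s + theta) bet * (s + theta) powr (- (b + real q)) -
        theta powr alpha * (?m (s + theta) bet * (s + theta) powr (- (b + real q + alpha)))))"
    using has_laplace_shift[OF has_laplace_suminf[OF lap K]] by blast
  then obtain K where "has_laplace (\<lambda>t. exp (- theta * t) * ?S t) (a - theta) K (\<lambda>s.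
      \<Sum>q. theta ^ q * (?m (s + theta) bet * (s + theta) powr (- (b + real q)) -
        theta powr alpha * (?m (s + theta) bet * (s + theta) powr (- (b + real q + alpha)))))"
    by blast
  then have "has_laplace (\<lambda>t. \<Sum>q. tempered_term theta alpha bet b g t q) (a - theta) K (\<lambda>s.
    (1 - bet * (s + theta) powr (- alpha)) powr (- g) * (s + theta) powr (- b) *
    (1 - theta powr alpha * (s + theta) powr (- alpha)) / (1 - theta / (s + theta)))"
  proof (rule has_laplace_cong)
    fix s assume "s > a - theta"
    then show "?m (s + theta) bet * (s + theta) powr (- b) *
      (1 - theta powr alpha * (s + theta) powr (- alpha)) / (1 - theta / (s + theta)) =
      (\<Sum>q. theta ^ q * (?m (s + theta) bet * (s + theta) powr (- (b + real q)) -
        theta powr alpha * (?m (s + theta) bet * (s + theta) powr (- (b + real q + alpha)))))"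
      using sums[of "s + theta" "?m (s + theta) bet" "- (theta powr alpha)"]
      by (intro sums_unique) simp
  next
    fix t :: real assume t: "t \<ge> 0"
    show "(\<Sum>q. tempered_term theta alpha bet b g t q) = exp (- theta * t) * ?S t"
      unfolding eq[OF t] by (rule suminf_mult[OF summable_rabs_cancel[OF summable_has_laplace[OF lap K t]]])
  qed
  then show "\<exists>K. has_laplace (\<lambda>t. \<Sum>q. tempered_term theta alpha bet b g t q) (a - theta) K (\<lambda>s.
    (1 - bet * (s + theta) powr (- alpha)) powr (- g) * (s + theta) powr (- b) *
    (1 - theta powr alpha * (s + theta) powr (- alpha)) / (1 - theta / (s + theta)))"
    by blast
qed

text \<open>With \<open>x = s + theta\<close> and \<open>p = x powr alpha\<close>, the four factors
  are \<open>p^g / (psi + c)^g\<close>, \<open>p^(1 - g) / x\<close>, \<open>psi / p\<close> and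
  \<open>s / x\<close>, the last as divisor. The exponent \<open>alpha * (g - 1) + 1\<close> is the
  one for which all powers of \<open>p\<close> and \<open>x\<close> cancel.\<close>

lemma tempered_laplace_transform_eq:
  fixes theta alpha c s :: real
  assumes "theta > 0" "alpha > 0" "s > 0" "g \<ge> 1" "theta powr alpha - c < (s + theta) powr alpha"
  defines "psi \<equiv> (s + theta) powr alpha - theta powr alpha"
  shows "(1 - (theta powr alpha - c) * (s + theta) powr (- alpha)) powr (- real g) *
      (s + theta) powr (- (alpha * (real g - 1) + 1)) *
      (1 - theta powr alpha * (s + theta) powr (- alpha)) / (1 - theta / (s + theta)) =
    psi / (s * (psi + c) ^ g)"
proof -
  let ?x = "s + theta" and ?p = "(s + theta) powr alpha"
  have x: "?x > 0" "?p > 0"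
    using assms by auto
  have pc: "psi + c > 0"
    using assms by (simp add: psi_def)
  have inv: "?x powr (- alpha) = 1 / ?p"
    using x by (simp add: powr_minus field_simps)
  have "(1 - (theta powr alpha - c) * ?x powr (- alpha)) = (psi + c) / ?p"
    using x by (simp add: inv psi_def field_simps)
  then have f1: "(1 - (theta powr alpha - c) * ?x powr (- alpha)) powr (- real g) = ?p ^ g / (psi + c) ^ g"
    using x pc by (simp add: powr_minus powr_realpow power_divide field_simps)
  have f2: "?x powr (- (alpha * (real g - 1) + 1)) = ?p / ?p ^ g / ?x"
  proof -
    have "?x powr (- (alpha * (real g - 1) + 1)) = ?x powr (alpha - real g * alpha - 1)"
      by (simp add: algebra_simps)
    also have "\<dots> = ?p / ?x powr (real g * alpha) / ?x"
      using x by (simp add: powr_diff)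
    also have "?x powr (real g * alpha) = ?p ^ g"
      using x by (simp add: powr_power)
    finally show ?thesis .
  qed
  have f4: "1 - theta / ?x = s / ?x"
    using x by (simp add: field_simps)
  have f3: "1 - theta powr alpha * ?x powr (- alpha) = psi / ?p"
    using x by (simp add: inv psi_def field_simps)
  have "s > 0" "psi + c \<noteq> 0" "?p \<noteq> 0" "?x \<noteq> 0"
    using assms(3) pc x by auto
  then show ?thesis
    unfolding f1 f2 f3 f4 by (simp add: divide_simps)
qed

section \<open>First passage times of subordinators\<close>

text \<open>The first passage time, set to 0 if the level is never exceeded, where \<^term>\<open>Inf {}\<close> would
  be unspecified.\<close>

definition first_passage :: "(real \<Rightarrow> real) \<Rightarrow> real \<Rightarrow> real" where
  "first_passage d t = (if \<exists>x>0. t < d x then Inf {x. 0 < x \<and> t < d x} else 0)"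

lemma first_passage_nonneg: "first_passage d t \<ge> 0"
  unfolding first_passage_def by (auto intro!: cInf_greatest)

lemma first_passage_le: "0 < x \<Longrightarrow> t < d x \<Longrightarrow> first_passage d t \<le> x"
  unfolding first_passage_def by (auto intro!: cInf_lower bdd_belowI[of _ 0])

lemma first_passage_ge:
  assumes "\<exists>x>0. t < d x" "\<And>x. 0 < x \<Longrightarrow> t < d x \<Longrightarrow> a \<le> x"
  shows "a \<le> first_passage d t"
  using assms unfolding first_passage_def by (auto intro!: cInf_greatest)

lemma of_rat_nonneg_of_less: "0 \<le> a \<Longrightarrow> a < real_of_rat q \<Longrightarrow> 0 \<le> q"
  by (metis less_imp_le order.trans zero_le_of_rat_iff)

text \<open>A point where \<open>d\<close> is at most \<open>t\<close> bounds the passage time from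
  below by monotonicity. Taking it rational reduces the event to countably many values of the path,
  which gives measurability.\<close>

lemma less_first_passage_iff:
  assumes d: "mono_on {0..} d" and ex: "\<exists>x>0. t < d x" and a: "a \<ge> 0"
  shows "a < first_passage d t \<longleftrightarrow> (\<exists>q::rat. a < of_rat q \<and> d (of_rat q) \<le> t)"
proof
  assume "a < first_passage d t"
  then obtain q :: rat where q: "a < of_rat q" "of_rat q < first_passage d t"
    using of_rat_dense by blast
  then have "d (of_rat q) \<le> t"
    using first_passage_le[of "of_rat q" t d] a by linarith
  with q show "\<exists>q::rat. a < of_rat q \<and> d (of_rat q) \<le> t"
    by blast
next
  assume "\<exists>q::rat. a < of_rat q \<and> d (of_rat q) \<le> t"
  then obtain q :: rat where q: "a < of_rat q" "d (of_rat q) \<le> t"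
    by blast
  have "of_rat q \<le> first_passage d t"
  proof (rule first_passage_ge[OF ex])
    fix x assume x: "0 < x" "t < d x"
    show "of_rat q \<le> x"
    proof (rule ccontr)
      assume "\<not> of_rat q \<le> x"
      then have "d x \<le> d (of_rat q)"
        using x of_rat_nonneg_of_less[OF a q(1)] by (intro mono_onD[OF d]) auto
      then show False
        using x q by linarith
    qed
  qed
  then show "a < first_passage d t"
    using q by linarith
qed

text \<open>Right continuity keeps \<open>d\<close> below \<open>t\<close> on some interval to the
  right of \<open>a\<close>, which contains a rational witness.\<close>

lemma less_first_passageI:
  assumes d: "mono_on {0..} d" "continuous (at_right a) d"
    and ex: "\<exists>x>0. t < d x" and a: "a \<ge> 0" "d a < t"
  shows "a < first_passage d t"
proof -
  have "\<forall>\<^sub>F x in at_right a. d x < t"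
    using d(2) a(2) by (intro order_tendstoD) (auto simp: continuous_within)
  then obtain b where b: "b > a" "\<And>y. a < y \<Longrightarrow> y < b \<Longrightarrow> d y < t"
    by (auto simp: eventually_at_right[of a "a + 1"])
  obtain q :: rat where "a < of_rat q" "of_rat q < b"
    using of_rat_dense[OF b(1)] by blast
  with b(2) show ?thesis
    unfolding less_first_passage_iff[OF d(1) ex a(1)] by (auto intro: less_imp_le)
qed

lemma first_passage_le_of_less:
  assumes d: "mono_on {0..} d" and ex: "\<exists>x>0. t < d x" and a: "a \<ge> 0" "t < d a"
  shows "first_passage d t \<le> a"
proof -
  have "\<not> a < first_passage d t"
    unfolding less_first_passage_iff[OF d ex a(1)]
  proof
    assume "\<exists>q::rat. a < of_rat q \<and> d (of_rat q) \<le> t"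
    then obtain q :: rat where q: "a < of_rat q" "d (of_rat q) \<le> t"
      by blast
    then have "d a \<le> d (of_rat q)"
      using a of_rat_nonneg_of_less[OF a(1) q(1)] by (intro mono_onD[OF d]) auto
    then show False
      using q a by linarith
  qed
  then show ?thesis
    by simp
qed

text \<open>A jump of the passage time comes from a flat piece of \<open>d\<close>, which strict
  monotonicity excludes. Jumps of \<open>d\<close> do no harm.\<close>

lemma tendsto_first_passage:
  assumes d: "strict_mono_on {0..} d" and ex: "\<And>t. \<exists>x>0. t < d x" and u: "(u \<longlongrightarrow> t) F"
  shows "((\<lambda>n. first_passage d (u n)) \<longlongrightarrow> first_passage d t) F"
proof (rule order_tendstoI)
  have mono: "mono_on {0..} d"
    by (rule strict_mono_on_imp_mono_on[OF d])
  fix x assume x: "x < first_passage d t"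
  show "\<forall>\<^sub>F n in F. x < first_passage d (u n)"
  proof (cases "x \<ge> 0")
    case True
    then obtain q :: rat where q: "x < of_rat q" "d (of_rat q) \<le> t"
      using x unfolding less_first_passage_iff[OF mono ex True] by blast
    \<comment> \<open>Moving from \<open>q\<close> back to \<open>r\<close> turns the weak
      inequality at level \<open>t\<close> into a strict one, which survives small changes of the
      level.\<close>
    obtain r :: rat where r: "x < of_rat r" "real_of_rat r < of_rat q"
      using of_rat_dense[OF q(1)] by blast
    have "d (of_rat r) < d (of_rat q)"
      using r of_rat_nonneg_of_less[OF True r(1)] of_rat_nonneg_of_less[OF True q(1)]
      by (intro strict_mono_onD[OF d]) auto
    then have "\<forall>\<^sub>F n in F. d (of_rat r) < u n"
      using q by (intro order_tendstoD(1)[OF u]) simp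
    then show ?thesis
      unfolding less_first_passage_iff[OF mono ex True]
      by eventually_elim (use r in \<open>auto intro: less_imp_le\<close>)
  next
    case False
    then show ?thesis
      using first_passage_nonneg by (intro always_eventually) (metis leI less_le_trans)
  qed
next
  fix x assume x: "first_passage d t < x"
  have "\<exists>y. 0 < y \<and> y < x \<and> t < d y"
  proof (rule ccontr)
    assume "\<not> ?thesis"
    then have "x \<le> first_passage d t"
      by (intro first_passage_ge[OF ex]) (meson not_le)
    with x show False
      by simp
  qed
  then obtain y where y: "0 < y" "y < x" "t < d y"
    by blast
  have "\<forall>\<^sub>F n in F. u n < d y"
    by (rule order_tendstoD(2)[OF u y(3)])
  then show "\<forall>\<^sub>F n in F. first_passage d (u n) < x"
    by eventually_elim (use first_passage_le[OF y(1)] y(2) in \<open>auto intro: le_less_trans\<close>)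
qed

lemma exceeds_iff:
  fixes d :: "real \<Rightarrow> real"
  assumes "mono_on {0..} d"
  shows "(\<exists>x>0. t < d x) \<longleftrightarrow> (\<exists>n. t < d (real (Suc n)))"
proof
  assume "\<exists>x>0. t < d x"
  then obtain x where x: "x > 0" "t < d x"
    by blast
  obtain n where "x \<le> real n"
    using real_arch_simple by blast
  then have "d x \<le> d (real (Suc n))"
    using x by (intro mono_onD[OF assms]) auto
  then show "\<exists>n. t < d (real (Suc n))"
    by (intro exI[of _ n]) (rule less_le_trans[OF x(2)])
qed (use of_nat_0_less_iff in blast)

text \<open>The space and the level are general because there are three uses: the original space,
  its product with the law of an exponential time, and the sigma-algebra generated by
  \<open>D\<close> alone.\<close>

lemma measurable_first_passage:
  assumes [measurable]: "\<And>x. (\<lambda>w. D x w) \<in> borel_measurable N" "T \<in> borel_measurable N"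
    and mono: "\<And>w. w \<in> space N \<Longrightarrow> mono_on {0..} (\<lambda>x. D x w)"
  shows "(\<lambda>w. first_passage (\<lambda>x. D x w) (T w)) \<in> borel_measurable N"
  unfolding borel_measurable_iff_greater
proof
  fix a
  show "{w \<in> space N. a < first_passage (\<lambda>x. D x w) (T w)} \<in> sets N"
  proof (cases "a \<ge> 0")
    case True
    have "{w \<in> space N. a < first_passage (\<lambda>x. D x w) (T w)} =
      {w \<in> space N. (\<exists>n. T w < D (real (Suc n)) w) \<and> (\<exists>q::rat. a < of_rat q \<and> D (of_rat q) w \<le> T w)}"
    proof (intro Collect_cong conj_cong refl)
      fix w assume w: "w \<in> space N"
      show "a < first_passage (\<lambda>x. D x w) (T w) \<longleftrightarrow>
        (\<exists>n. T w < D (real (Suc n)) w) \<and> (\<exists>q::rat. a < of_rat q \<and> D (of_rat q) w \<le> T w)"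
      proof (cases "\<exists>x>0. T w < D x w")
        case True
        then show ?thesis
          using less_first_passage_iff[OF mono[OF w] True \<open>a \<ge> 0\<close>] exceeds_iff[OF mono[OF w], of "T w"]
          by simp
      next
        case False
        then have "first_passage (\<lambda>x. D x w) (T w) = 0"
          unfolding first_passage_def by (rule if_not_P)
        then show ?thesis
          using False exceeds_iff[OF mono[OF w], of "T w"] \<open>a \<ge> 0\<close> by simp
      qed
    qed
    also have "\<dots> \<in> sets N"
      by measurable
    finally show ?thesis .
  next
    case False
    then have "a < first_passage (\<lambda>x. D x w) (T w)" for w
      using first_passage_nonneg[of "\<lambda>x. D x w" "T w"] by linarith
    then show ?thesis
      by simp
  qed
qed

text \<open>\<open>psi\<close> is the Laplace exponent. Its positivity makes the paths exceed every
  level; its divergence excludes compound Poisson paths, which are constant between jumps.\<close>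

locale subordinator = prob_space M for M :: "'a measure" +
  fixes D :: "real \<Rightarrow> 'a \<Rightarrow> real" and psi :: "real \<Rightarrow> real"
  assumes D_meas [measurable]: "\<And>x. D x \<in> borel_measurable M"
    and D_0: "\<And>w. w \<in> space M \<Longrightarrow> D 0 w = 0"
    and D_mono: "\<And>w. w \<in> space M \<Longrightarrow> mono_on {0..} (\<lambda>x. D x w)"
    and D_right: "\<And>w x. w \<in> space M \<Longrightarrow> x \<ge> 0 \<Longrightarrow> continuous (at_right x) (\<lambda>y. D y w)"
    and D_laplace: "\<And>x y s. 0 \<le> x \<Longrightarrow> x \<le> y \<Longrightarrow> 0 \<le> s \<Longrightarrow>
      (\<integral>w. exp (- s * (D y w - D x w)) \<partial>M) = exp (- (y - x) * psi s)"
    and psi_pos: "\<And>s. s > 0 \<Longrightarrow> psi s > 0"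
    and psi_at_top: "filterlim psi at_top at_top"
begin

definition "Y t w = first_passage (\<lambda>x. D x w) t"

lemma D_le: "w \<in> space M \<Longrightarrow> 0 \<le> x \<Longrightarrow> x \<le> y \<Longrightarrow> D x w \<le> D y w"
  by (rule mono_onD[OF D_mono]) auto

lemma D_nonneg: "w \<in> space M \<Longrightarrow> 0 \<le> x \<Longrightarrow> 0 \<le> D x w"
  using D_le[of w 0 x] D_0 by simp

lemma Y_meas [measurable]: "Y t \<in> borel_measurable M"
  unfolding Y_def by (intro measurable_first_passage D_mono) auto

lemma Y_nonneg: "Y t w \<ge> 0"
  by (simp add: Y_def first_passage_nonneg)

text \<open>Markov's inequality for the exponential of the increment. It serves with
  \<open>s = 1\<close> and \<open>y\<close> tending to infinity for unboundedness, and with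
  \<open>r = 0\<close> and \<open>s\<close> tending to infinity for strict increase.\<close>

lemma chernoff:
  assumes "0 \<le> x" "x \<le> y" "0 \<le> s"
  shows "prob {w \<in> space M. D y w - D x w \<le> r} \<le> exp (s * r - (y - x) * psi s)"
proof -
  have int: "integrable M (\<lambda>w. exp (- s * (D y w - D x w)))"
    using assms by (intro integrable_const_bound[of _ 1]) (auto intro!: AE_I2 D_le mult_nonneg_nonneg)
  have "prob {w \<in> space M. D y w - D x w \<le> r} = expectation (indicator {w \<in> space M. D y w - D x w \<le> r})"
    by simp
  also have "\<dots> \<le> expectation (\<lambda>w. exp (s * r) * exp (- s * (D y w - D x w)))"
  proof (rule integral_mono)
    fix w assume w: "w \<in> space M"
    have "1 \<le> exp (s * r) * exp (- s * (D y w - D x w))" if "D y w - D x w \<le> r"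
      using mult_left_mono[OF that assms(3)] by (simp add: mult_exp_exp algebra_simps)
    then show "indicator {w \<in> space M. D y w - D x w \<le> r} w \<le> exp (s * r) * exp (- s * (D y w - D x w))"
      by (auto split: split_indicator)
  next
    show "integrable M (indicator {w \<in> space M. D y w - D x w \<le> r} :: 'a \<Rightarrow> real)"
      by (intro integrable_real_indicator) (auto simp: emeasure_eq_measure)
  qed (use int in auto)
  also have "\<dots> = exp (s * r) * expectation (\<lambda>w. exp (- s * (D y w - D x w)))"
    by (rule integral_mult_right_zero)
  also have "\<dots> = exp (s * r - (y - x) * psi s)"
    unfolding D_laplace[OF assms] by (simp add: mult_exp_exp algebra_simps)
  finally show ?thesis .
qed

lemma AE_exceeds: "AE w in M. \<forall>t. \<exists>x>0. t < D x w"
proof -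
  have "AE w in M. \<exists>n. real k < D (real (Suc n)) w" for k :: nat
  proof -
    let ?A = "{w \<in> space M. \<forall>n. D (real (Suc n)) w \<le> real k}"
    have "prob ?A \<le> exp (real k - real (Suc n) * psi 1)" for n
    proof -
      have "prob ?A \<le> prob {w \<in> space M. D (real (Suc n)) w - D 0 w \<le> real k}"
        by (rule finite_measure_mono) (auto simp: D_0 simp del: of_nat_Suc)
      then show ?thesis
        using chernoff[of 0 "real (Suc n)" 1 "real k"] by simp
    qed
    moreover have "(\<lambda>n. exp (real k - real (Suc n) * psi 1)) \<longlonglongrightarrow> 0"
    proof -
      have "exp (real k - real (Suc n) * psi 1) = exp (real k) * exp (- psi 1) ^ Suc n" for n
        by (simp only: exp_of_nat_mult[symmetric] mult_exp_exp) (simp add: algebra_simps)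
      moreover have "(\<lambda>n. exp (real k) * exp (- psi 1) ^ Suc n) \<longlonglongrightarrow> exp (real k) * 0"
        using psi_pos[of 1] by (intro tendsto_intros LIMSEQ_Suc[OF LIMSEQ_power_zero]) simp
      ultimately show ?thesis
        by simp
    qed
    ultimately have "prob ?A \<le> 0"
      by (intro LIMSEQ_le_const[of _ 0 "prob ?A"]) auto
    then have "prob ?A = 0"
      by (simp add: measure_le_0_iff)
    then have "?A \<in> null_sets M"
      by (simp add: null_setsI emeasure_eq_measure)
    from AE_not_in[OF this] show ?thesis
      using AE_space by eventually_elim (auto simp: not_le)
  qed
  then have "AE w in M. \<forall>k::nat. \<exists>n. real k < D (real (Suc n)) w"
    by (simp add: AE_all_countable)
  then show ?thesis
  proof eventually_elim
    case (elim w)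
    show ?case
    proof
      fix t
      obtain k :: nat where k: "t \<le> real k"
        using real_arch_simple by blast
      from elim obtain n where "real k < D (real (Suc n)) w"
        by blast
      with k show "\<exists>x>0. t < D x w"
        by (intro exI[of _ "real (Suc n)"]) auto
    qed
  qed
qed

lemma AE_strict_mono: "AE w in M. strict_mono_on {0..} (\<lambda>x. D x w)"
proof -
  have *: "AE w in M. D x w < D y w" if "0 \<le> x" "x < y" for x y
  proof -
    let ?A = "{w \<in> space M. D y w - D x w \<le> 0}"
    have "((\<lambda>s. exp (- ((y - x) * psi s))) \<longlongrightarrow> 0) at_top"
    proof (rule filterlim_compose[OF exp_at_bot])
      show "filterlim (\<lambda>s. - ((y - x) * psi s)) at_bot at_top"
        unfolding filterlim_uminus_at_bot minus_minus
        using that psi_at_top by (intro filterlim_tendsto_pos_mult_at_top[OF tendsto_const]) auto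
    qed
    moreover have "\<forall>\<^sub>F s in at_top. prob ?A \<le> exp (- ((y - x) * psi s))"
      using eventually_ge_at_top[of 0]
    proof eventually_elim
      case (elim s)
      then show ?case
        using chernoff[of x y s 0] that by simp
    qed
    ultimately have "prob ?A \<le> 0"
      by (intro tendsto_lowerbound) auto
    then have "prob ?A = 0"
      by (simp add: measure_le_0_iff)
    then have "?A \<in> null_sets M"
      by (simp add: null_setsI emeasure_eq_measure)
    from AE_not_in[OF this] show ?thesis
      using AE_space by eventually_elim (auto simp: not_le)
  qed
  have "AE w in M. \<forall>q r::rat. 0 \<le> q \<and> q < r \<longrightarrow> D (of_rat q) w < D (of_rat r) w"
    unfolding AE_all_countable
    using * by (auto simp: of_rat_less)
  with AE_space show ?thesis
  proof eventually_elim
    case (elim w)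
    show ?case
    proof (rule strict_mono_onI)
      fix x y :: real assume xy: "x \<in> {0..}" "y \<in> {0..}" "x < y"
      \<comment> \<open>Two rationals between \<open>x\<close> and \<open>y\<close> reduce strict
        increase to countably many null sets, the path being monotone.\<close>
      obtain r :: rat where r: "x < of_rat r" "of_rat r < y"
        using of_rat_dense[OF xy(3)] by blast
      obtain q :: rat where q: "x < of_rat q" "of_rat q < real_of_rat r"
        using of_rat_dense[OF r(1)] by blast
      have "0 \<le> q"
        using xy q by (intro of_rat_nonneg_of_less[of x]) auto
      have "D x w \<le> D (of_rat q) w"
        using elim q xy by (intro D_le) auto
      also have "\<dots> < D (of_rat r) w"
        using elim \<open>0 \<le> q\<close> q by (simp add: of_rat_less)
      also have "\<dots> \<le> D y w"
        using elim r xy of_rat_nonneg_of_less[of x r] by (intro D_le) auto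
      finally show "D x w < D y w" .
    qed
  qed
qed

lemma continuous_on_expectation_Y:
  fixes phi :: "real \<Rightarrow> real"
  assumes phi: "continuous_on {0..} phi" "phi \<in> borel_measurable borel"
    and bound: "\<And>x. x \<ge> 0 \<Longrightarrow> \<bar>phi x\<bar> \<le> B"
  shows "continuous_on A (\<lambda>t. expectation (\<lambda>w. phi (Y t w)))"
  unfolding continuous_on_sequentially
proof (intro allI ballI impI)
  fix u t assume "t \<in> A" and u: "(\<forall>n. u n \<in> A) \<and> u \<longlonglongrightarrow> t"
  have "(\<lambda>n. expectation (\<lambda>w. phi (Y (u n) w))) \<longlonglongrightarrow> expectation (\<lambda>w. phi (Y t w))"
  proof (rule integral_dominated_convergence[where w = "\<lambda>_. B"])
    show "AE w in M. (\<lambda>n. phi (Y (u n) w)) \<longlonglongrightarrow> phi (Y t w)"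
      using AE_exceeds AE_strict_mono
    proof eventually_elim
      case (elim w)
      then have "(\<lambda>n. Y (u n) w) \<longlonglongrightarrow> Y t w"
        unfolding Y_def using u by (intro tendsto_first_passage) auto
      then show ?case
        using phi(1) Y_nonneg unfolding continuous_on_sequentially by (auto simp: o_def)
    qed
  qed (use phi(2) bound Y_nonneg in \<open>auto intro!: measurable_compose[OF Y_meas]\<close>)
  then show "((\<lambda>t. expectation (\<lambda>w. phi (Y t w))) \<circ> u) \<longlonglongrightarrow> expectation (\<lambda>w. phi (Y t w))"
    by (simp add: o_def)
qed

text \<open>Up to a null set, the events that Y exceeds a at time t and that D a is at most t agree.\<close>

lemma distributed_Y_exponential_time:
  assumes s: "s > 0"
  defines "N \<equiv> density lborel (exponential_density s) \<Otimes>\<^sub>M M"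
  shows "distributed N lborel (\<lambda>(t, w). Y t w) (exponential_density (psi s))"
proof -
  let ?E = "density lborel (exponential_density s)"
  interpret E: prob_space ?E
    by (rule prob_space_exponential_density[OF s])
  interpret EM: pair_prob_space ?E M ..
  have Y_pair: "(\<lambda>z. Y (fst z) (snd z)) \<in> borel_measurable N"
    unfolding Y_def N_def
  proof (rule measurable_first_passage)
    show "(\<lambda>z. D x (snd z)) \<in> borel_measurable (?E \<Otimes>\<^sub>M M)" for x
      by measurable
    show "fst \<in> borel_measurable (?E \<Otimes>\<^sub>M M)"
      by (rule measurable_compose[OF measurable_fst]) simp
    show "mono_on {0..} (\<lambda>x. D x (snd z))" if "z \<in> space (?E \<Otimes>\<^sub>M M)" for z
      using that by (intro D_mono) (auto simp: space_pair_measure)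
  qed
  show ?thesis
    unfolding case_prod_beta
  proof (rule exponential_distributedI[OF Y_pair psi_pos[OF s]])
    fix a :: real assume a: "0 \<le> a"
    let ?A = "{z \<in> space N. Y (fst z) (snd z) \<le> a}"
    have A: "?A \<in> sets (?E \<Otimes>\<^sub>M M)"
      using Y_pair unfolding N_def by measurable
    have "emeasure N ?A = (\<integral>\<^sup>+w. emeasure ?E ((\<lambda>t. (t, w)) -` ?A) \<partial>M)"
      unfolding N_def by (rule EM.emeasure_pair_measure_alt2[OF A[unfolded N_def]])
    also have "\<dots> = (\<integral>\<^sup>+w. ennreal (1 - exp (- s * D a w)) \<partial>M)"
    proof (rule nn_integral_cong_AE)
      show "AE w in M. emeasure ?E ((\<lambda>t. (t, w)) -` ?A) = ennreal (1 - exp (- s * D a w))"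
        using AE_exceeds AE_space
      proof eventually_elim
        case (elim w)
        note w = \<open>w \<in> space M\<close>
        have ex: "\<exists>x>0. t < D x w" for t
          using elim by blast
        have "emeasure ?E ((\<lambda>t. (t, w)) -` ?A) = emeasure ?E {..D a w}"
        proof (rule emeasure_eq_AE)
          have "AE t in lborel. t \<noteq> D a w"
            by (rule AE_lborel_singleton)
          then have "AE t in ?E. t \<noteq> D a w"
            by (auto simp: AE_density)
          then show "AE t in ?E. t \<in> (\<lambda>t. (t, w)) -` ?A \<longleftrightarrow> t \<in> {..D a w}"
          proof eventually_elim
            case (elim t)
            have "Y t w \<le> a \<longleftrightarrow> t \<le> D a w"
            proof (cases "t < D a w")
              case True
              then show ?thesis
                using first_passage_le_of_less[OF D_mono[OF w] ex a] by (simp add: Y_def)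
            next
              case False
              then show ?thesis
                using less_first_passageI[OF D_mono[OF w] D_right[OF w a] ex a, of t] elim
                by (simp add: Y_def)
            qed
            then show ?case
              using \<open>w \<in> space M\<close> by (simp add: N_def space_pair_measure)
          qed
          show "(\<lambda>t. (t, w)) -` ?A \<in> sets ?E"
            by (rule sets_Pair2[OF A])
        qed simp
        also have "\<dots> = ennreal (1 - exp (- s * D a w))"
          using elim a s D_nonneg[of w a] by (simp add: emeasure_erlang_density erlang_CDF_0)
        finally show ?case .
      qed
    qed
    also have "\<dots> = ennreal (expectation (\<lambda>w. 1 - exp (- s * D a w)))"
    proof (rule nn_integral_eq_integral)
      show "integrable M (\<lambda>w. 1 - exp (- s * D a w))"
        using s a D_nonneg
        by (intro Bochner_Integration.integrable_diff integrable_const integrable_const_bound[of _ 1])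
          (auto intro!: AE_I2 mult_nonneg_nonneg)
      show "AE w in M. 0 \<le> 1 - exp (- s * D a w)"
        using s a D_nonneg by (intro AE_I2) auto
    qed
    also have "expectation (\<lambda>w. 1 - exp (- s * D a w)) = 1 - exp (- a * psi s)"
    proof -
      have "integrable M (\<lambda>w. exp (- s * D a w))"
        using s a D_nonneg
        by (intro integrable_const_bound[of _ 1]) (auto intro!: AE_I2 mult_nonneg_nonneg)
      then have "expectation (\<lambda>w. 1 - exp (- s * D a w)) = 1 - expectation (\<lambda>w. exp (- s * D a w))"
        by (simp add: prob_space)
      also have "expectation (\<lambda>w. exp (- s * D a w)) = expectation (\<lambda>w. exp (- s * (D a w - D 0 w)))"
        by (intro Bochner_Integration.integral_cong) (auto simp: D_0)
      finally show ?thesis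
        using D_laplace[of 0 a s] s a by simp
    qed
    finally show "emeasure N ?A = 1 - ennreal (exp (- a * psi s))"
      by (simp add: ennreal_minus ennreal_1[symmetric] del: ennreal_1)
  qed
qed

lemma laplace_expectation_Y:
  fixes phi :: "real \<Rightarrow> real"
  assumes s: "s > 0" and phi [measurable]: "phi \<in> borel_measurable borel"
    and bound: "\<And>x. x \<ge> 0 \<Longrightarrow> \<bar>phi x\<bar> \<le> B"
  shows "(\<integral>t. exponential_density s t * expectation (\<lambda>w. phi (Y t w)) \<partial>lborel) =
    (\<integral>x. exponential_density (psi s) x * phi x \<partial>lborel)"
proof -
  let ?E = "density lborel (exponential_density s)"
  interpret E: prob_space ?E
    by (rule prob_space_exponential_density[OF s])
  interpret EM: pair_prob_space ?E M ..
  note dist = distributed_Y_exponential_time[OF s]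
  have [measurable]: "(\<lambda>(t, w). Y t w) \<in> borel_measurable (?E \<Otimes>\<^sub>M M)"
    using distributed_measurable[OF dist] by simp
  have int: "integrable (?E \<Otimes>\<^sub>M M) (\<lambda>(t, w). phi (Y t w))"
    using bound Y_nonneg
    by (intro EM.P.integrable_const_bound[of _ B]) (auto intro!: AE_I2)
  have "(\<integral>x. exponential_density (psi s) x * phi x \<partial>lborel) =
      (\<integral>z. phi ((\<lambda>(t, w). Y t w) z) \<partial>(?E \<Otimes>\<^sub>M M))"
    using psi_pos[OF s] by (intro distributed_integral[OF dist]) auto
  also have "\<dots> = (\<integral>t. \<integral>w. phi (Y t w) \<partial>M \<partial>?E)"
    using EM.integral_fst'[OF int] by (simp add: case_prod_unfold)
  also have "\<dots> = (\<integral>t. exponential_density s t * expectation (\<lambda>w. phi (Y t w)) \<partial>lborel)"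
  proof (rule integral_real_density)
    show "(\<lambda>t. expectation (\<lambda>w. phi (Y t w))) \<in> borel_measurable lborel"
      using borel_measurable_lebesgue_integral[of "\<lambda>t w. phi (Y t w)" ?E] by simp
  qed (use s in auto)
  finally show ?thesis ..
qed

end

section \<open>Observation at an independent random time\<close>

text \<open>The rounded-down grid point plus one step lies strictly to the right of
  \<open>y\<close>, the side on which the paths of the chain are constant for a while.\<close>

lemma eventually_floor_grid:
  assumes "y \<ge> 0" "e > 0"
  shows "\<forall>\<^sub>F n in sequentially. y < (real (nat \<lfloor>real (Suc n) * y\<rfloor>) + 1) / real (Suc n) \<and>
    (real (nat \<lfloor>real (Suc n) * y\<rfloor>) + 1) / real (Suc n) < y + e"
proof -
  have "\<forall>\<^sub>F n in sequentially. 1 / real (Suc n) < e"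
    using LIMSEQ_inverse_real_of_nat assms(2) by (auto simp: inverse_eq_divide dest: order_tendstoD)
  then show ?thesis
  proof eventually_elim
    case (elim n)
    let ?j = "real (nat \<lfloor>real (Suc n) * y\<rfloor>)"
    have "?j = of_int \<lfloor>real (Suc n) * y\<rfloor>"
      using assms by simp
    then have j: "?j \<le> real (Suc n) * y" "real (Suc n) * y < ?j + 1"
      by linarith+
    then have "y < (?j + 1) / real (Suc n)"
      by (simp add: pos_less_divide_eq mult.commute)
    moreover have "(?j + 1) / real (Suc n) \<le> (real (Suc n) * y + 1) / real (Suc n)"
      using j(1) by (intro divide_right_mono) linarith+
    then have "(?j + 1) / real (Suc n) \<le> y + 1 / real (Suc n)"
      by (simp add: add_divide_distrib del: of_nat_Suc)
    ultimately show ?case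
      using elim by linarith
  qed
qed

text \<open>The time T is approximated from the right by times with values in a grid.\<close>

lemma (in prob_space)
  fixes Q :: "real \<Rightarrow> 'a \<Rightarrow> 'b" and T :: "'a \<Rightarrow> real" and i :: 'b
  defines "p \<equiv> \<lambda>s. prob {w \<in> space M. Q s w = i}"
  assumes Q [measurable]: "\<And>s. Q s \<in> measurable M (count_space UNIV)"
    and right: "\<And>w s. w \<in> space M \<Longrightarrow> s \<ge> 0 \<Longrightarrow> \<exists>e>0. \<forall>u. s \<le> u \<and> u < s + e \<longrightarrow> Q u w = Q s w"
    and T [measurable]: "T \<in> borel_measurable M" and T_nonneg: "\<And>w. w \<in> space M \<Longrightarrow> T w \<ge> 0"
    and indep: "\<And>s A. A \<in> sets borel \<Longrightarrow>
      prob ({w \<in> space M. Q s w = i} \<inter> {w \<in> space M. T w \<in> A}) = p s * prob {w \<in> space M. T w \<in> A}"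
    and cont: "continuous_on {0..} p"
  shows event_independent_time: "{w \<in> space M. Q (T w) w = i} \<in> events"
    and prob_independent_time: "prob {w \<in> space M. Q (T w) w = i} = expectation (\<lambda>w. p (T w))"
proof -
  define K where "K n w = nat \<lfloor>real (Suc n) * T w\<rfloor>" for n w
  define grid where "grid n j = (real j + 1) / real (Suc n)" for n j :: nat
  have K_meas [measurable]: "K n \<in> measurable M (count_space UNIV)" for n
    unfolding K_def by measurable
  define A where "A n = {w \<in> space M. Q (grid n (K n w)) w = i}" for n
  have A_eq: "A n = (\<Union>j. {w \<in> space M. Q (grid n j) w = i} \<inter> {w \<in> space M. K n w = j})" for n
    by (auto simp: A_def)
  have A_meas [measurable]: "A n \<in> events" for n
    unfolding A_eq by measurable
  have ev: "\<forall>\<^sub>F n in sequentially. Q (grid n (K n w)) w = Q (T w) w" if w: "w \<in> space M" for w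
  proof -
    obtain e where e: "e > 0" "\<And>u. T w \<le> u \<Longrightarrow> u < T w + e \<Longrightarrow> Q u w = Q (T w) w"
      using right[OF w T_nonneg[OF w]] by blast
    show ?thesis
      using eventually_floor_grid[OF T_nonneg[OF w] e(1)]
    proof eventually_elim
      case (elim n)
      then show ?case
        unfolding K_def grid_def by (intro e(2) less_imp_le) auto
    qed
  qed
  have grid_lim: "(\<lambda>n. grid n (K n w)) \<longlonglongrightarrow> T w" if w: "w \<in> space M" for w
  proof (rule tendstoI)
    fix e :: real assume "e > 0"
    from eventually_floor_grid[OF T_nonneg[OF w] this]
    show "\<forall>\<^sub>F n in sequentially. dist (grid n (K n w)) (T w) < e"
      by eventually_elim (simp add: K_def grid_def dist_real_def)
  qed
  \<comment> \<open>Along the grid times the path finally takes the value at \<open>T w\<close>, so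
    the event is a lower limit of the events \<open>A n\<close>.\<close>
  have "{w \<in> space M. Q (T w) w = i} = {w \<in> space M. \<exists>N. \<forall>n\<ge>N. w \<in> A n}"
  proof (intro Collect_cong conj_cong refl)
    fix w assume w: "w \<in> space M"
    obtain N where N: "\<And>n. n \<ge> N \<Longrightarrow> Q (grid n (K n w)) w = Q (T w) w"
      using ev[OF w] by (auto simp: eventually_sequentially)
    show "Q (T w) w = i \<longleftrightarrow> (\<exists>N. \<forall>n\<ge>N. w \<in> A n)"
    proof
      assume "\<exists>N. \<forall>n\<ge>N. w \<in> A n"
      then obtain N' where "\<And>n. n \<ge> N' \<Longrightarrow> w \<in> A n"
        by blast
      then have "w \<in> A (max N N')"
        by simp
      then show "Q (T w) w = i"
        using N[of "max N N'"] by (simp add: A_def)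
    qed (use N w in \<open>auto simp: A_def\<close>)
  qed
  also have "\<dots> \<in> events"
    by measurable
  finally show B: "{w \<in> space M. Q (T w) w = i} \<in> events" .
  have p_bound: "0 \<le> p s" "p s \<le> 1" for s
    by (simp_all add: p_def)
  \<comment> \<open>On each part of the partition by \<open>K n\<close> the grid time is
    deterministic, so independence at a fixed time applies.\<close>
  have prob_A: "prob (A n) = expectation (\<lambda>w. p (grid n (K n w)))" for n
  proof -
    have "emeasure M (A n) = (\<Sum>j. emeasure M ({w \<in> space M. Q (grid n j) w = i} \<inter> {w \<in> space M. K n w = j}))"
      unfolding A_eq by (rule suminf_emeasure[symmetric]) (auto simp: disjoint_family_on_def)
    also have "\<dots> = (\<Sum>j. ennreal (p (grid n j)) * emeasure M {w \<in> space M. K n w = j})"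
    proof (rule suminf_cong)
      fix j
      have "{w \<in> space M. K n w = j} = {w \<in> space M. T w \<in> {y. nat \<lfloor>real (Suc n) * y\<rfloor> = j}}"
        by (simp add: K_def)
      moreover have "{y::real. nat \<lfloor>real (Suc n) * y\<rfloor> = j} \<in> sets borel"
        by measurable
      ultimately show "emeasure M ({w \<in> space M. Q (grid n j) w = i} \<inter> {w \<in> space M. K n w = j}) =
          ennreal (p (grid n j)) * emeasure M {w \<in> space M. K n w = j}"
        using indep[of "{y. nat \<lfloor>real (Suc n) * y\<rfloor> = j}" "grid n j"] p_bound
        by (simp add: emeasure_eq_measure ennreal_mult[symmetric])
    qed
    also have "\<dots> = (\<Sum>j. \<integral>\<^sup>+w. ennreal (p (grid n j)) * indicator {w \<in> space M. K n w = j} w \<partial>M)"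
      by (intro suminf_cong nn_integral_cmult_indicator[symmetric]) measurable
    also have "\<dots> = (\<integral>\<^sup>+w. (\<Sum>j. ennreal (p (grid n j)) * indicator {w \<in> space M. K n w = j} w) \<partial>M)"
      by (intro nn_integral_suminf[symmetric]) measurable
    also have "\<dots> = (\<integral>\<^sup>+w. ennreal (p (grid n (K n w))) \<partial>M)"
    proof (rule nn_integral_cong)
      fix w assume w: "w \<in> space M"
      have "(\<Sum>j. ennreal (p (grid n j)) * indicator {w \<in> space M. K n w = j} w) =
          (\<Sum>j\<in>{K n w}. ennreal (p (grid n j)) * indicator {w \<in> space M. K n w = j} w)"
        by (rule suminf_finite) (auto split: split_indicator)
      then show "(\<Sum>j. ennreal (p (grid n j)) * indicator {w \<in> space M. K n w = j} w) =
          ennreal (p (grid n (K n w)))"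
        using w by simp
    qed
    also have "\<dots> = ennreal (expectation (\<lambda>w. p (grid n (K n w))))"
      using p_bound by (intro nn_integral_eq_integral integrable_const_bound[of _ 1]) auto
    finally show ?thesis
      using p_bound by (simp add: emeasure_eq_measure Bochner_Integration.integral_nonneg)
  qed
  \<comment> \<open>The probabilities of \<open>A n\<close> have two limits: one by continuity of
    \<open>p\<close>, the other because the paths are finally constant along the grid.\<close>
  have "(\<lambda>n. prob (A n)) \<longlonglongrightarrow> expectation (\<lambda>w. p (T w))"
    unfolding prob_A
  proof (rule integral_dominated_convergence[where w = "\<lambda>_. 1"])
    have lim: "(\<lambda>n. p (grid n (K n w))) \<longlonglongrightarrow> p (T w)" if w: "w \<in> space M" for w
      using cont grid_lim[OF w] T_nonneg[OF w]
      unfolding continuous_on_sequentially by (auto simp: o_def grid_def)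
    show meas: "(\<lambda>w. p (grid n (K n w))) \<in> borel_measurable M" for n
      by measurable
    show "(\<lambda>w. p (T w)) \<in> borel_measurable M"
      by (rule borel_measurable_LIMSEQ_real[OF lim meas])
    show "AE w in M. (\<lambda>n. p (grid n (K n w))) \<longlonglongrightarrow> p (T w)"
      using lim by (intro AE_I2)
  qed (use p_bound in auto)
  moreover have "(\<lambda>n. prob (A n)) \<longlonglongrightarrow> prob {w \<in> space M. Q (T w) w = i}"
  proof -
    have "(\<lambda>n. expectation (indicator (A n))) \<longlonglongrightarrow>
        expectation (indicator {w \<in> space M. Q (T w) w = i} :: 'a \<Rightarrow> real)"
    proof (rule integral_dominated_convergence[where w = "\<lambda>_. 1"])
      show "AE w in M. (\<lambda>n. indicator (A n) w) \<longlonglongrightarrow> (indicator {w \<in> space M. Q (T w) w = i} w :: real)"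
      proof (rule AE_I2)
        fix w assume w: "w \<in> space M"
        show "(\<lambda>n. indicator (A n) w) \<longlonglongrightarrow> (indicator {w \<in> space M. Q (T w) w = i} w :: real)"
          by (rule tendsto_eventually, use ev[OF w] in eventually_elim)
            (use w in \<open>simp add: A_def indicator_def\<close>)
      qed
    qed (use B in \<open>auto split: split_indicator\<close>)
    then show ?thesis
      using B by simp
  qed
  ultimately show "prob {w \<in> space M. Q (T w) w = i} = expectation (\<lambda>w. p (T w))"
    by (rule LIMSEQ_unique[symmetric])
qed

section \<open>Transforms of expectations at the passage time\<close>

lemma power_div_fact_le_exp: "0 \<le> x \<Longrightarrow> x ^ n / fact n \<le> exp x" for x :: real
  using sum_le_suminf[OF summable_exp_generic, of "{n}" x] 
  by (simp add: exp_def scaleR_conv_of_real field_simps)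

context subordinator
begin

text \<open>The exponential density of rate \<open>psi s\<close> times the given function is
  \<open>psi s / (psi s + c) ^ Suc n\<close> times an Erlang density of rate
  \<open>psi s + c\<close>. The bound comes from \<open>(c * x) ^ n / fact n\<close> being at most
  \<open>exp (c * x)\<close>.\<close>

lemma has_laplace_expectation_Y:
  assumes c: "c > 0"
  shows "has_laplace (\<lambda>t. expectation (\<lambda>w. Y t w ^ n * exp (- c * Y t w) / fact n)) 0 (1 / c ^ n)
    (\<lambda>s. psi s / (s * (psi s + c) ^ Suc n))"
proof -
  define phi where "phi x = x ^ n * exp (- c * x) / fact n" for x :: real
  have phi_cont: "continuous_on A phi" for A
    unfolding phi_def by (intro continuous_intros) auto
  have phi_meas [measurable]: "phi \<in> borel_measurable borel"
    unfolding phi_def by measurable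
  have bound: "\<bar>phi x\<bar> \<le> 1 / c ^ n" if "x \<ge> 0" for x
  proof -
    have "(c * x) ^ n / fact n \<le> exp (c * x)"
      using c that by (intro power_div_fact_le_exp) simp
    then have "(c * x) ^ n / fact n * exp (- c * x) \<le> exp (c * x) * exp (- c * x)"
      by (intro mult_right_mono) auto
    then have "c ^ n * phi x \<le> 1"
      by (simp add: phi_def power_mult_distrib mult_exp_exp)
    then show ?thesis
      using c that by (simp add: phi_def field_simps)
  qed
  have "has_laplace (\<lambda>t. expectation (\<lambda>w. phi (Y t w))) 0 (1 / c ^ n)
    (\<lambda>s. psi s / (s * (psi s + c) ^ Suc n))"
  proof (rule has_laplaceI)
    show "continuous_on {0..} (\<lambda>t. expectation (\<lambda>w. phi (Y t w)))"
      by (rule continuous_on_expectation_Y[OF phi_cont phi_meas bound])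
    show "\<bar>expectation (\<lambda>w. phi (Y t w))\<bar> \<le> 1 / c ^ n * exp (0 * t)" for t
    proof -
      have "\<bar>expectation (\<lambda>w. phi (Y t w))\<bar> \<le> expectation (\<lambda>w. \<bar>phi (Y t w)\<bar>)"
        by (rule integral_abs_bound)
      also have "\<dots> \<le> expectation (\<lambda>w. 1 / c ^ n)"
        using bound Y_nonneg
        by (intro integral_mono integrable_const integrable_abs integrable_const_bound[of _ "1 / c ^ n"]) auto
      finally show ?thesis
        by (simp add: prob_space)
    qed
    fix s :: real assume s: "s > 0"
    have psi: "psi s > 0"
      by (rule psi_pos[OF s])
    have "(LINT t:{0..}|lborel. exp (- s * t) * expectation (\<lambda>w. phi (Y t w))) =
        (\<integral>t. 1 / s * (exponential_density s t * expectation (\<lambda>w. phi (Y t w))) \<partial>lborel)"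
      unfolding set_lebesgue_integral_def
      using s by (intro Bochner_Integration.integral_cong) (auto simp: erlang_density_def split: split_indicator)
    also have "\<dots> = 1 / s * (\<integral>x. exponential_density (psi s) x * phi x \<partial>lborel)"
      using laplace_expectation_Y[OF s phi_meas bound] by simp
    also have "(\<integral>x. exponential_density (psi s) x * phi x \<partial>lborel) =
        (\<integral>x. psi s / (psi s + c) ^ Suc n * erlang_density n (psi s + c) x \<partial>lborel)"
    proof (intro Bochner_Integration.integral_cong refl)
      fix x
      have "exp (- psi s * x) * exp (- c * x) = exp (- (psi s + c) * x)"
        by (simp add: mult_exp_exp algebra_simps)
      then show "exponential_density (psi s) x * phi x =
          psi s / (psi s + c) ^ Suc n * erlang_density n (psi s + c) x"
        using psi c by (simp add: erlang_density_def phi_def)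
    qed
    also have "\<dots> = psi s / (psi s + c) ^ Suc n"
    proof -
      have "(\<integral>\<^sup>+x. ennreal (erlang_density n (psi s + c) x) \<partial>lborel) = ennreal 1"
        using nn_integral_erlang_ith_moment[of "psi s + c" n 0] psi c by simp
      then have "has_bochner_integral lborel (erlang_density n (psi s + c)) 1"
        using psi c by (intro has_bochner_integral_nn_integral) auto
      then show ?thesis
        by (simp add: has_bochner_integral_integral_eq)
    qed
    finally show "(LINT t:{0..}|lborel. exp (- s * t) * expectation (\<lambda>w. phi (Y t w))) =
        psi s / (s * (psi s + c) ^ Suc n)"
      by simp
  qed
  then show ?thesis
    by (simp add: phi_def)
qed

end

section \<open>The tempered queue\<close>

lemma continuous_erlang_trans_zero:
  assumes "k \<ge> 1" "mu > 0" "\<And>j. j \<in> {1..l} \<Longrightarrow> lam j \<ge> 0"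
  shows "continuous_on A (\<lambda>t. erlang_trans k l mu lam t (0, 0) (0, 0))"
proof -
  let ?f = "\<lambda>N. walk_weight k l (real k * mu) lam N 0 / fact N"
  have "summable (\<lambda>N. ?f N * t ^ N)" for t
    using summable_norm_cancel[OF summable_walk_weight[where lam = lam and l = l, OF assms]]
    by (simp add: mult_ac)
  then have "isCont (\<lambda>t. \<Sum>N. ?f N * t ^ N) t" for t
    by (rule isCont_powser_converges_everywhere)
  then have "continuous_on A (\<lambda>t. \<Sum>N. ?f N * t ^ N)"
    by (simp add: continuous_at_imp_continuous_on)
  moreover have "erlang_trans k l mu lam t (0, 0) (0, 0) =
      exp (- ((\<Sum>j=1..l. lam j) + real k * mu) * t) * (\<Sum>N. ?f N * t ^ N)" for t
    using erlang_trans_walk_weight[where lam = lam and l = l, OF assms] by (simp add: mult_ac)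
  ultimately show ?thesis
    by (simp only:) (intro continuous_intros)
qed

lemma (in subordinator) expectation_Y_eq_series:
  assumes psi: "\<And>s. s > 0 \<Longrightarrow> psi s = (s + theta) powr alpha - theta powr alpha"
    and "theta > 0" "alpha > 0" "c > 0" "t \<ge> 0"
  shows "summable (tempered_term theta alpha (theta powr alpha - c) (beta0 alpha (Suc n)) (real (Suc n)) t)"
    and "expectation (\<lambda>w. Y t w ^ n * exp (- c * Y t w) / fact n) =
      (\<Sum>q. tempered_term theta alpha (theta powr alpha - c) (beta0 alpha (Suc n)) (real (Suc n)) t q)"
proof -
  let ?bet = "theta powr alpha - c" and ?b = "beta0 alpha (Suc n)"
  \<comment> \<open>The first entry exceeds \<open>theta\<close>, for the geometric series. The
    second makes \<open>a powr alpha\<close> exceed the absolute value of \<open>?bet\<close>, for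
    the binomial series.\<close>
  define a where "a = max (theta + 1) ((\<bar>?bet\<bar> + 1) powr (1 / alpha))"
  have a: "a > theta" "a > 0"
    using assms by (auto simp: a_def)
  have "\<bar>?bet\<bar> + 1 = ((\<bar>?bet\<bar> + 1) powr (1 / alpha)) powr alpha"
    using assms by (simp add: powr_powr)
  also have "\<dots> \<le> a powr alpha"
    using assms by (intro powr_mono2) (auto simp: a_def)
  finally have bet: "\<bar>?bet\<bar> < a powr alpha"
    by linarith
  have b: "?b \<ge> 1"
    using assms by (simp add: beta0_def)
  show "summable (tempered_term theta alpha ?bet ?b (real (Suc n)) t)"
    using assms a bet b by (intro summable_tempered_term[of _ _ _ _ a]) auto
  obtain K where K: "has_laplace (\<lambda>t. \<Sum>q. tempered_term theta alpha ?bet ?b (real (Suc n)) t q) (a - theta) K (\<lambda>s.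
    (1 - ?bet * (s + theta) powr (- alpha)) powr (- real (Suc n)) * (s + theta) powr (- ?b) *
    (1 - theta powr alpha * (s + theta) powr (- alpha)) / (1 - theta / (s + theta)))"
    using has_laplace_tempered_term[of ?b alpha "real (Suc n)" theta a ?bet] assms a bet b by auto
  show "expectation (\<lambda>w. Y t w ^ n * exp (- c * Y t w) / fact n) =
      (\<Sum>q. tempered_term theta alpha ?bet ?b (real (Suc n)) t q)"
  proof (rule has_laplace_unique[OF has_laplace_expectation_Y[OF assms(4)] K assms(5)])
    fix s assume "s > max 0 (a - theta)"
    then have s: "s > 0" "s + theta > a"
      by auto
    then have "?bet < (s + theta) powr alpha"
      using bet powr_mono2[of alpha a "s + theta"] assms a by linarith
    from tempered_laplace_transform_eq[OF assms(2,3) s(1) _ this, of "Suc n"]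
    show "psi s / (s * (psi s + c) ^ Suc n) =
      (1 - ?bet * (s + theta) powr (- alpha)) powr (- real (Suc n)) * (s + theta) powr (- ?b) *
      (1 - theta powr alpha * (s + theta) powr (- alpha)) / (1 - theta / (s + theta))"
      unfolding psi[OF s(1)] beta0_def by simp
  qed
qed

lemma tempered_exponent_at_top:
  fixes theta alpha :: real
  assumes "alpha > 0"
  shows "filterlim (\<lambda>s. (s + theta) powr alpha - theta powr alpha) at_top at_top"
proof -
  have "filterlim (\<lambda>s::real. theta + s) at_top at_top"
    by (rule filterlim_tendsto_add_at_top[OF tendsto_const filterlim_ident])
  then have "filterlim (\<lambda>s. s + theta) at_top at_top"
    by (simp add: add.commute)
  then have "filterlim (\<lambda>s. alpha * ln (s + theta)) at_top at_top"
    using assms by (intro filterlim_tendsto_pos_mult_at_top[OF tendsto_const] filterlim_compose[OF ln_at_top])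
  then have "filterlim (\<lambda>s. exp (alpha * ln (s + theta))) at_top at_top"
    by (rule filterlim_compose[OF exp_at_top])
  moreover have "\<forall>\<^sub>F s in at_top. exp (alpha * ln (s + theta)) = (s + theta) powr alpha"
    using eventually_gt_at_top[of "- theta"] by eventually_elim (simp add: powr_def)
  ultimately have "filterlim (\<lambda>s. (s + theta) powr alpha) at_top at_top"
    by (rule filterlim_mono_eventually[OF _ order.refl order.refl])
  then have "filterlim (\<lambda>s. - (theta powr alpha) + (s + theta) powr alpha) at_top at_top"
    by (rule filterlim_tendsto_add_at_top[OF tendsto_const])
  then show ?thesis
    by simp
qed

text \<open>A finite total forces every inner series and then the outer one to converge, so the real
  sums on the right are genuine limits.\<close>

lemma iterated_suminf_ennreal:
  fixes a :: "nat \<Rightarrow> nat \<Rightarrow> real"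
  assumes "\<And>i j. a i j \<ge> 0" "x \<ge> 0" "ennreal x = (\<Sum>i. \<Sum>j. ennreal (a i j))"
  shows "x = (\<Sum>i. \<Sum>j. a i j)"
proof -
  have inner: "(\<Sum>j. ennreal (a i j)) = ennreal (\<Sum>j. a i j) \<and> 0 \<le> (\<Sum>j. a i j)" for i
  proof -
    have "(\<Sum>j. ennreal (a i j)) = (\<Sum>i\<in>{i}. \<Sum>j. ennreal (a i j))"
      by simp
    also have "\<dots> \<le> (\<Sum>i. \<Sum>j. ennreal (a i j))"
      by (rule sum_le_suminf) auto
    finally have "(\<Sum>j. ennreal (a i j)) \<noteq> top"
      using assms(3) by (auto simp: top_unique)
    then have "summable (a i)"
      using assms(1) by (intro summable_suminf_not_top) auto
    then show ?thesis
      using assms(1) by (simp add: suminf_ennreal2 suminf_nonneg)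
  qed
  then have eq: "ennreal x = (\<Sum>i. ennreal (\<Sum>j. a i j))"
    using assms(3) by simp
  then have "(\<Sum>i. ennreal (\<Sum>j. a i j)) \<noteq> top"
    by (metis ennreal_neq_top)
  then have "summable (\<lambda>i. \<Sum>j. a i j)"
    using inner by (intro summable_suminf_not_top) auto
  then have "ennreal x = ennreal (\<Sum>i. \<Sum>j. a i j)"
    using inner eq by (simp add: suminf_ennreal2)
  moreover have "0 \<le> (\<Sum>i. \<Sum>j. a i j)"
    using \<open>summable (\<lambda>i. \<Sum>j. a i j)\<close> by (rule suminf_nonneg) (use inner in blast)
  ultimately show ?thesis
    using assms(2) by simp
qed

theorem theorem3p2:
  fixes k l :: nat and mu theta alpha t :: real and lam :: "nat \<Rightarrow> real"
    and M :: "'w measure" and Q :: "real \<Rightarrow> 'w \<Rightarrow> nat \<times> nat" and D :: "real \<Rightarrow> 'w \<Rightarrow> real"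
  defines "Lam \<equiv> \<Sum>m=1..l. lam m"
    and "c \<equiv> \<lambda>m. lam m / (\<Sum>i=1..l. lam i)"
    and "bet \<equiv> theta powr alpha - (\<Sum>i=1..l. lam i) - real k * mu"
    and "Y \<equiv> \<lambda>s \<omega>. Inf {x. 0 < x \<and> s < D x \<omega>}"
  assumes "k \<ge> 1" and "l \<ge> 1" and "mu > 0" and "\<forall>m\<in>{1..l}. lam m > 0"
    and "theta > 0" and "0 < alpha" and "alpha < 1" and "t \<ge> 0"
    and "prob_space M"
    \<comment> \<open>Q: the Erlang queue with multiple arrivals, a CTMC started at (0,0)\<close>
    and "\<forall>s. Q s \<in> measurable M (count_space UNIV)"
    and "\<forall>\<omega>\<in>space M. Q 0 \<omega> = (0, 0)"
    and "\<forall>\<omega>\<in>space M. \<forall>s\<ge>0. \<exists>e>0. \<forall>u. s \<le> u \<and> u < s + e \<longrightarrow> Q u \<omega> = Q s \<omega>"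
    and "\<forall>n (ts :: nat \<Rightarrow> real) (ss :: nat \<Rightarrow> nat \<times> nat).
           0 \<le> ts 0 \<and> (\<forall>i<n. ts i \<le> ts (Suc i)) \<longrightarrow>
           measure M {\<omega> \<in> space M. \<forall>i\<le>n. Q (ts i) \<omega> = ss i}
             = erlang_trans k l mu lam (ts 0) (0, 0) (ss 0)
               * (\<Prod>i<n. erlang_trans k l mu lam (ts (Suc i) - ts i) (ss i) (ss (Suc i)))"
    \<comment> \<open>D: tempered stable subordinator\<close>
    and "\<forall>x. D x \<in> borel_measurable M"
    and "\<forall>\<omega>\<in>space M. D 0 \<omega> = 0 \<and> mono_on {0..} (\<lambda>x. D x \<omega>)
           \<and> (\<forall>x\<ge>0. continuous (at_right x) (\<lambda>y. D y \<omega>))"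
    and "\<forall>n (xs :: nat \<Rightarrow> real). 0 \<le> xs 0 \<and> (\<forall>i<n. xs i \<le> xs (Suc i)) \<longrightarrow>
           prob_space.indep_vars M (\<lambda>_. borel) (\<lambda>i \<omega>. D (xs (Suc i)) \<omega> - D (xs i) \<omega>) {..<n}"
    and "\<forall>x y s. 0 \<le> x \<longrightarrow> x \<le> y \<longrightarrow> 0 \<le> s \<longrightarrow>
           (\<integral>\<omega>. exp (- s * (D y \<omega> - D x \<omega>)) \<partial>M)
             = exp (- (y - x) * ((s + theta) powr alpha - theta powr alpha))"
    \<comment> \<open>independence of the two processes\<close>
    and "prob_space.indep_set M
           (sets (vimage_algebra (space M) (\<lambda>\<omega> s. Q s \<omega>) (Pi\<^sub>M UNIV (\<lambda>_. count_space UNIV))))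
           (sets (vimage_algebra (space M) (\<lambda>\<omega> x. D x \<omega>) (Pi\<^sub>M UNIV (\<lambda>_. borel))))"
  shows "measure M {\<omega> \<in> space M. Q (Y t \<omega>) \<omega> = (0, 0)}
    = (\<Sum>h0. \<Sum>n. \<Sum>m\<in>multi_idx l n. \<Sum>q.
         let h = Suc h0; g = gamma0 k l h n m; b = beta0 alpha g in
         C0 k l mu Lam c h n m * exp (- theta * t) * theta ^ q * pw t (b + real q - 1)
         * (mittag_leffler3 alpha (b + real q) (real g) (bet * t powr alpha)
            - (theta * t) powr alpha
              * mittag_leffler3 alpha (b + alpha + real q) (real g) (bet * t powr alpha)))"
proof -
  note par = assms(5-12)
  note Q_meas = assms(14) and Q_right = assms(16) and Q_law = assms(17)
  note D_meas = assms(18) and D_path = assms(19) and D_laplace = assms(21) and indep = assms(22)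
  interpret prob_space M
    by fact
  define psi where "psi s = (s + theta) powr alpha - theta powr alpha" for s
  interpret S: subordinator M D psi
  proof
    show "0 < psi s" if "s > 0" for s
      using that par powr_less_mono2[of alpha theta "s + theta"] by (simp add: psi_def)
    show "filterlim psi at_top at_top"
      unfolding psi_def using par by (intro tempered_exponent_at_top)
  qed (use D_meas D_path D_laplace in \<open>auto simp: psi_def\<close>)
  have lam: "lam j > 0" if "j \<in> {1..l}" for j
    using par that by blast
  have lam': "lam j \<ge> 0" if "j \<in> {1..l}" for j
    using lam[OF that] by simp
  have Lam: "Lam > 0"
    unfolding Lam_def using par by (intro sum_pos lam) auto
  define cc where "cc = Lam + real k * mu"
  have cc: "cc > 0"
    unfolding cc_def using Lam par by (intro add_pos_nonneg) auto
  have bet: "bet = theta powr alpha - cc"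
    by (simp add: bet_def cc_def Lam_def)
  have c: "c = (\<lambda>j. lam j / Lam)"
    by (simp add: c_def Lam_def)
  define p where "p s = prob {w \<in> space M. Q s w = (0, 0)}" for s
  have p_eq: "p s = erlang_trans k l mu lam s (0, 0) (0, 0)" if "s \<ge> 0" for s
    using Q_law[rule_format, of "\<lambda>_. s" 0 "\<lambda>_. (0, 0)"] that by (simp add: p_def)
  have p_cont: "continuous_on {0..} p"
    using continuous_erlang_trans_zero[where lam = lam and l = l, OF par(1,3) lam', of "{0..}"]
    by (subst continuous_on_cong[OF refl p_eq]) auto
  let ?T = "S.Y t"
  have joint: "prob ({w \<in> space M. Q s w = (0, 0)} \<inter> {w \<in> space M. ?T w \<in> A}) =
      p s * prob {w \<in> space M. ?T w \<in> A}" if A: "A \<in> sets borel" for s and A :: "real set"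
    unfolding p_def
  proof (rule indep_setD[OF indep])
    let ?VQ = "vimage_algebra (space M) (\<lambda>w s. Q s w) (Pi\<^sub>M UNIV (\<lambda>_. count_space UNIV))"
    let ?VD = "vimage_algebra (space M) (\<lambda>w x. D x w) (Pi\<^sub>M UNIV (\<lambda>_. borel))"
    have "(\<lambda>w s. Q s w) \<in> measurable ?VQ (Pi\<^sub>M UNIV (\<lambda>_. count_space UNIV))"
      by (rule measurable_vimage_algebra1) (auto simp: space_PiM)
    then have [measurable]: "Q s \<in> measurable ?VQ (count_space UNIV)"
      by (rule measurable_compose[OF _ measurable_component_singleton]) simp
    have "{w \<in> space ?VQ. Q s w = (0, 0)} \<in> sets ?VQ"
      by measurable
    then show "{w \<in> space M. Q s w = (0, 0)} \<in> sets ?VQ"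
      by simp
    have "(\<lambda>w x. D x w) \<in> measurable ?VD (Pi\<^sub>M UNIV (\<lambda>_. borel))"
      by (rule measurable_vimage_algebra1) (auto simp: space_PiM)
    then have "D x \<in> borel_measurable ?VD" for x
      by (rule measurable_compose[OF _ measurable_component_singleton]) simp
    \<comment> \<open>The passage time is a function of the path of \<open>D\<close> alone, so
      independence of the two sigma-algebras applies to it.\<close>
    then have "?T \<in> borel_measurable ?VD"
      unfolding S.Y_def using S.D_mono by (intro measurable_first_passage) auto
    from measurable_sets[OF this A] show "{w \<in> space M. ?T w \<in> A} \<in> sets ?VD"
      by (simp add: vimage_def Int_def conj_commute)
  qed
  note time = event_independent_time[where Q = Q and T = ?T and i = "(0, 0)"]
    prob_independent_time[where Q = Q and T = ?T and i = "(0, 0)"]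
  have time_event: "{w \<in> space M. Q (?T w) w = (0, 0)} \<in> events"
    and time_prob: "prob {w \<in> space M. Q (?T w) w = (0, 0)} = expectation (\<lambda>w. p (?T w))"
    using Q_meas Q_right S.Y_nonneg joint p_cont by (auto simp: p_def intro!: time)
  \<comment> \<open>\<open>Y\<close> and \<open>S.Y\<close> differ at most where the level is never
    exceeded, which is a null set.\<close>
  have "prob {w \<in> space M. Q (Y t w) w = (0, 0)} = prob {w \<in> space M. Q (?T w) w = (0, 0)}"
  proof (rule measure_eq_AE)
    show "AE w in M. w \<in> {w \<in> space M. Q (Y t w) w = (0, 0)} \<longleftrightarrow> w \<in> {w \<in> space M. Q (?T w) w = (0, 0)}"
      using S.AE_exceeds by eventually_elim (simp add: Y_def S.Y_def first_passage_def)
    have [measurable]: "Measurable.pred M (\<lambda>w. \<exists>x>0. t < D x w)"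
    proof (subst measurable_cong)
      show "(\<exists>x>0. t < D x w) \<longleftrightarrow> (\<exists>n. t < D (real (Suc n)) w)" if "w \<in> space M" for w
        by (rule exceeds_iff[OF S.D_mono[OF that]])
    qed measurable
    have [measurable]: "Measurable.pred M (\<lambda>w. Q (?T w) w = (0, 0))" "Q (Inf {}) \<in> measurable M (count_space UNIV)"
      using time_event Q_meas by (auto simp: pred_def)
    \<comment> \<open>Where the level is never exceeded, \<open>Y\<close> is the fixed real number
      \<open>Inf {}\<close>. The chain is then observed at one deterministic time, so this part of
      the event is measurable too.\<close>
    have "{w \<in> space M. Q (Y t w) w = (0, 0)} =
        {w \<in> space M. if \<exists>x>0. t < D x w then Q (?T w) w = (0, 0) else Q (Inf {}) w = (0, 0)}"
    proof (intro Collect_cong conj_cong refl)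
      fix w
      show "Q (Y t w) w = (0, 0) \<longleftrightarrow>
        (if \<exists>x>0. t < D x w then Q (?T w) w = (0, 0) else Q (Inf {}) w = (0, 0))"
      proof (cases "\<exists>x>0. t < D x w")
        case True
        then show ?thesis
          by (simp add: Y_def S.Y_def first_passage_def)
      next
        case False
        then have "{x. 0 < x \<and> t < D x w} = {}"
          by blast
        then show ?thesis
          unfolding if_not_P[OF False] Y_def by (simp only:)
      qed
    qed
    also have "\<dots> \<in> events"
      by measurable
    finally show "{w \<in> space M. Q (Y t w) w = (0, 0)} \<in> events" .
  qed fact
  also have "\<dots> = expectation (\<lambda>w. p (?T w))"
    by (rule time_prob)
  also have "\<dots> = (\<Sum>h0. \<Sum>n. \<Sum>m\<in>multi_idx l n. C0 k l mu Lam c (Suc h0) n m *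
      (\<Sum>q. tempered_term theta alpha bet (beta0 alpha (gamma0 k l (Suc h0) n m))
        (real (gamma0 k l (Suc h0) n m)) t q))" (is "_ = (\<Sum>h0. \<Sum>n. ?R h0 n)")
  proof -
    let ?g = "\<lambda>h0 n m. gamma0 k l (Suc h0) n m" and ?C = "\<lambda>h0 n m. C0 k l mu Lam c (Suc h0) n m"
    let ?phi = "\<lambda>j w. ?T w ^ j * exp (- cc * ?T w) / fact j"
    have C: "?C h0 n m \<ge> 0" for h0 n m
      unfolding c using par Lam lam' by (intro C0_nonneg) auto
    have phi: "expectation (?phi (?g h0 n m - 1)) =
        (\<Sum>q. tempered_term theta alpha bet (beta0 alpha (?g h0 n m)) (real (?g h0 n m)) t q)" for h0 n m
    proof -
      have "Suc (?g h0 n m - 1) = ?g h0 n m"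
        using gamma0_ge[of "Suc h0" n k l m] by simp
      then show ?thesis
        using S.expectation_Y_eq_series(2)[OF psi_def par(5,6) cc par(8), of "?g h0 n m - 1"]
        by (simp only: bet)
    qed
    have phi_int: "integrable M (?phi j)" for j
    proof (rule integrable_const_bound)
      show "AE w in M. norm (?phi j w) \<le> 1 / cc ^ j"
      proof (rule AE_I2)
        fix w
        have "(cc * ?T w) ^ j / fact j \<le> exp (cc * ?T w)"
          using cc S.Y_nonneg[of t w] by (intro power_div_fact_le_exp) simp
        then show "norm (?phi j w) \<le> 1 / cc ^ j"
          using cc S.Y_nonneg[of t w] by (simp add: power_mult_distrib exp_minus field_simps)
      qed
    qed measurable
    have p_bound: "0 \<le> p s" "p s \<le> 1" for s
      by (simp_all add: p_def)
    have p_meas [measurable]: "(\<lambda>w. p (?T w)) \<in> borel_measurable M"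
    proof -
      have "(\<lambda>x. indicator {0..} x *\<^sub>R p x) \<in> borel_measurable borel"
        by (rule borel_measurable_continuous_on_indicator[OF _ p_cont]) simp
      from measurable_compose[OF S.Y_meas this] show ?thesis
        using S.Y_nonneg by simp
    qed
    \<comment> \<open>In \<open>ennreal\<close> the expansion of \<open>p\<close> may be integrated
      termwise without any summability; the return to the reals uses that the total is
      finite.\<close>
    have "ennreal (expectation (\<lambda>w. p (?T w))) = (\<integral>\<^sup>+w. ennreal (p (?T w)) \<partial>M)"
      using p_bound by (intro nn_integral_eq_integral[symmetric] integrable_const_bound[of _ 1]) auto
    also have "\<dots> = (\<integral>\<^sup>+w. (\<Sum>h0. \<Sum>n. \<Sum>m\<in>multi_idx l n.
        ennreal (?C h0 n m * ?phi (?g h0 n m - 1) w)) \<partial>M)"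
      unfolding p_eq[OF S.Y_nonneg] c cc_def
      using erlang_trans_zero_expansion[where lam = lam and l = l, OF par(1-3) lam S.Y_nonneg]
      by (simp add: Let_def Lam_def)
    also have "\<dots> = (\<Sum>h0. \<Sum>n. \<Sum>m\<in>multi_idx l n. \<integral>\<^sup>+w. ennreal (?C h0 n m * ?phi (?g h0 n m - 1) w) \<partial>M)"
      by (simp add: nn_integral_suminf nn_integral_sum)
    also have "\<dots> = (\<Sum>h0. \<Sum>n. \<Sum>m\<in>multi_idx l n. ennreal (?C h0 n m * expectation (?phi (?g h0 n m - 1))))"
    proof (intro suminf_cong sum.cong refl)
      fix h0 n m
      have "(\<integral>\<^sup>+w. ennreal (?C h0 n m * ?phi (?g h0 n m - 1) w) \<partial>M) =
          ennreal (expectation (\<lambda>w. ?C h0 n m * ?phi (?g h0 n m - 1) w))"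
        using C S.Y_nonneg phi_int
        by (intro nn_integral_eq_integral integrable_mult_right AE_I2 mult_nonneg_nonneg
            divide_nonneg_nonneg zero_le_power) auto
      then show "(\<integral>\<^sup>+w. ennreal (?C h0 n m * ?phi (?g h0 n m - 1) w) \<partial>M) =
          ennreal (?C h0 n m * expectation (?phi (?g h0 n m - 1)))"
        by (simp only: integral_mult_right_zero)
    qed
    also have "\<dots> = (\<Sum>h0. \<Sum>n. ennreal (\<Sum>m\<in>multi_idx l n. ?C h0 n m * expectation (?phi (?g h0 n m - 1))))"
      using C S.Y_nonneg
      by (intro suminf_cong sum_ennreal mult_nonneg_nonneg Bochner_Integration.integral_nonneg divide_nonneg_nonneg zero_le_power) auto
    finally have "ennreal (expectation (\<lambda>w. p (?T w))) =
        (\<Sum>h0. \<Sum>n. ennreal (\<Sum>m\<in>multi_idx l n. ?C h0 n m * expectation (?phi (?g h0 n m - 1))))" .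
    then have "expectation (\<lambda>w. p (?T w)) =
        (\<Sum>h0. \<Sum>n. \<Sum>m\<in>multi_idx l n. ?C h0 n m * expectation (?phi (?g h0 n m - 1)))"
      using C S.Y_nonneg p_bound
      by (intro iterated_suminf_ennreal sum_nonneg mult_nonneg_nonneg Bochner_Integration.integral_nonneg
          divide_nonneg_nonneg zero_le_power) auto
    then show ?thesis
      unfolding phi .
  qed
  also have "\<dots> = (\<Sum>h0. \<Sum>n. \<Sum>m\<in>multi_idx l n. \<Sum>q.
         let h = Suc h0; g = gamma0 k l h n m; b = beta0 alpha g in
         C0 k l mu Lam c h n m * exp (- theta * t) * theta ^ q * pw t (b + real q - 1)
         * (mittag_leffler3 alpha (b + real q) (real g) (bet * t powr alpha)
            - (theta * t) powr alpha
              * mittag_leffler3 alpha (b + alpha + real q) (real g) (bet * t powr alpha)))"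
  \<comment> \<open>Moving \<open>C0\<close> under the sum over q requires its summability, which
    comes from the growth bounds, as its terms need not be nonnegative.\<close>
  proof (intro suminf_cong sum.cong refl)
    fix h0 n m
    let ?g = "gamma0 k l (Suc h0) n m"
    have "Suc (?g - 1) = ?g"
      using gamma0_ge[of "Suc h0" n k l m] by simp
    then have "summable (tempered_term theta alpha bet (beta0 alpha ?g) (real ?g) t)"
      using S.expectation_Y_eq_series(1)[OF psi_def par(5,6) cc par(8), of "?g - 1"] by (simp only: bet)
    then have "C0 k l mu Lam c (Suc h0) n m * (\<Sum>q. tempered_term theta alpha bet (beta0 alpha ?g) (real ?g) t q) =
        (\<Sum>q. C0 k l mu Lam c (Suc h0) n m * tempered_term theta alpha bet (beta0 alpha ?g) (real ?g) t q)"
      by (rule suminf_mult[symmetric])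
    also have "\<dots> = (\<Sum>q. let h = Suc h0; g = gamma0 k l h n m; b = beta0 alpha g in
         C0 k l mu Lam c h n m * exp (- theta * t) * theta ^ q * pw t (b + real q - 1)
         * (mittag_leffler3 alpha (b + real q) (real g) (bet * t powr alpha)
            - (theta * t) powr alpha
              * mittag_leffler3 alpha (b + alpha + real q) (real g) (bet * t powr alpha)))"
      by (simp only: tempered_term_def Let_def mult.assoc)
    finally show "C0 k l mu Lam c (Suc h0) n m *
      (\<Sum>q. tempered_term theta alpha bet (beta0 alpha ?g) (real ?g) t q) = \<dots>" .
  qed
  finally show ?thesis .
qed

end
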